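(* Let $q,t,v,w$ be real with $|q|\le t\le1$, $|v|\le w\le1$, let $n\ge1$, and let $\xi_i\in H_{\mathbb R}$, $\xi_{\bar i}\in\bar H_{\mathbb R}$ for $i\in\{1,\dots,n\}$. Then $$\varphi\big(G_{\xi_1\otimes\xi_{\bar1}}\cdots G_{\xi_n\otimes\xi_{\bar n}}\big)=\sum_{\pi\in\mathcal P_2^{\otimes}(n)}q^{\mathrm{cr}(\pi|_{[n]})}\,t^{\mathrm{nest}(\pi|_{[n]})}\,v^{\mathrm{cr}(\pi|_{[\bar n]})}\,w^{\mathrm{nest}(\pi|_{[\bar n]})}\prod_{(a,b)\in\pi|_{[n]}}\langle\xi_a,\xi_b\rangle_H\prod_{(\bar a,\bar c)\in\pi|_{[\bar n]}}\langle\xi_{\bar a},\xi_{\bar c}\rangle_{\bar H},$$ where pairs are written with the smaller element first (equivalently, the product is over the diagonal blocks $(a,b)\otimes(\bar a,\bar c)$ of $\pi$ of the factors $\langle\xi_a\otimes\xi_{\bar a},\xi_b\otimes\xi_{\bar c}\rangle$, where $(a,b)\in\pi|_{[n]}$ and $(\bar a,\bar c)\in\pi|_{[\bar n]}$ have the same left leg).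
   Context: Convention: $0^0=1$; an empty sum is $0$. Combinatorics. $[n]=\{1,\dots,n\}$, and $[\bar n]=\{\bar1<\dots<\bar n\}$ is a disjoint copy. $\mathcal P_2^\otimes(n)$, the set of diagonal pair partitions, is the set of partitions $\pi$ of $[n]\sqcup[\bar n]$ into two-element blocks such that each block lies entirely in $[n]$ or entirely in $[\bar n]$, and the set of openers (smaller elements of pairs) of $\pi|_{[n]}$ coincides with that of $\pi|_{[\bar n]}$ under $i\leftrightarrow\bar i$. For a pair partition $\rho$ of a linearly ordered set, $\mathrm{cr}(\rho)$ is the number of (unordered) pairs of blocks $\{(i,j),(i',j')\}$ with $i<i'<j<j'$, and $\mathrm{nest}(\rho)$ is the number of pairs of blocks with $i<i'<j'<j$. Operators. $H$ and $\bar H$ are two separable complex Hilbert spaces, complexifications of real Hilbert spaces $H_{\mathbb R},\bar H_{\mathbb R}$; inner products are linear in the second variable. ($\bar H$ is just the name of a second space; there is no relation between $\xi_i$ and $\xi_{\bar i}$.) For $n\ge 1$ define on $H^{\otimes n}$ $$P^{(n)}_{q,t}(\eta_1\otimes\cdots\otimes\eta_n)=\sum_{\sigma\in S_n}q^{l_1(\sigma)}t^{\binom n2-l_1(\sigma)}\,\eta_{\sigma(1)}\otimes\cdots\otimes\eta_{\sigma(n)},$$ $l_1(\sigma)$ being the number of inversions of $\sigma$, and $P^{(0)}_{q,t}=I$ on $\mathbb C\Omega$; define $P^{(n)}_{v,w}$ on $\bar H^{\otimes n}$ in the same way (vacuum vector $\bar\Omega$). The algebraic diagonal Fock space is $\mathcal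 F_{\rm dig}=\bigoplus_{n\ge0}H^{\otimes n}\otimes\bar H^{\otimes n}$ (finite sums), with $n=0$ term $\mathbb C\,\Omega\otimes\bar\Omega$, carrying the positive semi-definite form $\langle f,g\rangle_{q,t,v,w}=\delta_{n,m}\langle f,(P^{(n)}_{q,t}\otimes P^{(n)}_{v,w})g\rangle$ for $f$ in degree $m$, $g$ in degree $n$; the quadrabasic Fock space is its completion (after dividing by the kernel if necessary). For $\xi\in H_{\mathbb R}$: $a^*_{q,t}(\xi)\Omega=\xi$, $a^*_{q,t}(\xi)\eta_1\otimes\cdots\otimes\eta_n=\xi\otimes\eta_1\otimes\cdots\otimes\eta_n$, $a_{q,t}(\xi)\Omega=0$, $a_{q,t}(\xi)\eta_1\otimes\cdots\otimes\eta_n=\sum_{i=1}^nq^{i-1}t^{n-i}\langle\xi,\eta_i\rangle\,\eta_1\otimes\cdots\otimes\hat\eta_i\otimes\cdots\otimes\eta_n$; similarly for $a_{v,w},a^*_{v,w}$ over $\bar H$. On $\mathcal F_{\rm dig}$, $\mathbf A_{\xi\otimes\eta}=a_{q,t}(\xi)\otimes a_{v,w}(\eta)$, $\mathbf A^*_{\xi\otimes\eta}=a^*_{q,t}(\xi)\otimes a^*_{v,w}(\eta)$ and $G_{\xi\otimes\eta}=\mathbf A_{\xi\otimes\eta}+\mathbf A^*_{\xi\otimes\eta}$ for $\xi\in H_{\mathbb R},\eta\in\bar H_{\mathbb R}$. The vacuum state is $\varphi(\cdot)=\langle\Omega\otimes\bar\Omega,\ \cdot\ \Omega\otimes\bar\Omega\rangle_{q,t,v,w}$.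 *)

theory Defs
  imports "HOL-Analysis.Analysis" "HOL-Combinatorics.Permutations" "HOL-Library.Disjoint_Sets" "HOL-Library.Poly_Mapping"
begin

section \<open>Complexification of a real inner product space\<close>

datatype 'a complexification = Complexification (re_part: 'a) (im_part: 'a)

instantiation complexification :: (ab_group_add) ab_group_add
begin

definition "0 = Complexification 0 0"
definition "x + y = Complexification (re_part x + re_part y) (im_part x + im_part y)"
definition "x - y = Complexification (re_part x - re_part y) (im_part x - im_part y)"
definition "- x = Complexification (- re_part x) (- im_part x)"

instance
  by standard
    (auto simp: zero_complexification_def plus_complexification_def
      minus_complexification_def uminus_complexification_def)

end

definition cscale :: "complex \<Rightarrow> 'a::real_vector complexification \<Rightarrow> 'a complexification" where
  "cscale c x = Complexification (Re c *\<^sub>R re_part x - Im c *\<^sub>R im_part x)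
                                 (Re c *\<^sub>R im_part x + Im c *\<^sub>R re_part x)"

definition cplx :: "'a::real_vector \<Rightarrow> 'a complexification" where
  "cplx x = Complexification x 0"

text \<open>Antilinear in the first variable, linear in the second.\<close>

definition cinner :: "'a::real_inner complexification \<Rightarrow> 'a complexification \<Rightarrow> complex" where
  "cinner x y = Complex (inner (re_part x) (re_part y) + inner (im_part x) (im_part y))
                        (inner (re_part x) (im_part y) - inner (im_part x) (re_part y))"

lemma cinner_add_right: "cinner x (y + z) = cinner x y + cinner x z"
  by (simp add: cinner_def plus_complexification_def inner_add_right complex_eq_iff)

lemma cinner_scale_right: "cinner x (cscale c y) = c * cinner x y"
  by (simp add: cinner_def cscale_def inner_add_right inner_diff_right complex_eq_iff algebra_simps)

lemma cinner_commute: "cinner x y = cnj (cinner y x)"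
  by (simp add: cinner_def complex_eq_iff inner_commute)

lemma cinner_cplx: "cinner (cplx x) (cplx y) = complex_of_real (inner x y)"
  by (simp add: cinner_def cplx_def complex_eq_iff)


section \<open>Formal linear combinations\<close>

text \<open>
  The type \<open>'k \<Rightarrow>\<^sub>0 complex\<close> is the free complex vector space on \<open>'k\<close>, with basis
  vectors \<open>word k\<close>. A list \<open>[x\<^sub>1, \<dots>, x\<^sub>n]\<close> stands for the pure tensor
  \<open>x\<^sub>1 \<otimes> \<dots> \<otimes> x\<^sub>n\<close>; multilinearity is imposed below by passing to a quotient.
\<close>

definition word :: "'k \<Rightarrow> ('k \<Rightarrow>\<^sub>0 complex)" where
  "word k = Poly_Mapping.single k 1"

definition fscale :: "complex \<Rightarrow> ('k \<Rightarrow>\<^sub>0 complex) \<Rightarrow> ('k \<Rightarrow>\<^sub>0 complex)" where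
  "fscale c f = Poly_Mapping.map ((*) c) f"

text \<open>The linear extension of a map on basis vectors.\<close>

definition lin_ext :: "('k \<Rightarrow> ('l \<Rightarrow>\<^sub>0 complex)) \<Rightarrow> ('k \<Rightarrow>\<^sub>0 complex) \<Rightarrow> ('l \<Rightarrow>\<^sub>0 complex)" where
  "lin_ext \<Phi> f = (\<Sum>k\<in>Poly_Mapping.keys f. fscale (Poly_Mapping.lookup f k) (\<Phi> k))"

text \<open>The sesquilinear extension of a kernel on basis vectors.\<close>

definition sesq_ext :: "('k \<Rightarrow> 'k \<Rightarrow> complex) \<Rightarrow> ('k \<Rightarrow>\<^sub>0 complex) \<Rightarrow> ('k \<Rightarrow>\<^sub>0 complex) \<Rightarrow> complex" where
  "sesq_ext B f g = (\<Sum>k\<in>Poly_Mapping.keys f. \<Sum>l\<in>Poly_Mapping.keys g.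
     cnj (Poly_Mapping.lookup f k) * Poly_Mapping.lookup g l * B k l)"

definition ftensor ::
  "('k \<Rightarrow>\<^sub>0 complex) \<Rightarrow> ('l \<Rightarrow>\<^sub>0 complex) \<Rightarrow> ('k \<times> 'l \<Rightarrow>\<^sub>0 complex)" where
  "ftensor f g = lin_ext (\<lambda>k. lin_ext (\<lambda>l. word (k, l)) g) f"

text \<open>The tensor product of two linear maps given on basis vectors.\<close>

definition op_tensor ::
  "('k \<Rightarrow> ('k \<Rightarrow>\<^sub>0 complex)) \<Rightarrow> ('l \<Rightarrow> ('l \<Rightarrow>\<^sub>0 complex)) \<Rightarrow>
   ('k \<times> 'l \<Rightarrow>\<^sub>0 complex) \<Rightarrow> ('k \<times> 'l \<Rightarrow>\<^sub>0 complex)" where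
  "op_tensor \<Phi> \<Psi> = lin_ext (\<lambda>(k, l). ftensor (\<Phi> k) (\<Psi> l))"

inductive_set cspan :: "('k \<Rightarrow>\<^sub>0 complex) set \<Rightarrow> ('k \<Rightarrow>\<^sub>0 complex) set"
  for S :: "('k \<Rightarrow>\<^sub>0 complex) set" where
  zero: "0 \<in> cspan S"
| step: "s \<in> S \<Longrightarrow> f \<in> cspan S \<Longrightarrow> fscale c s + f \<in> cspan S"

lemma lookup_fscale [simp]: "Poly_Mapping.lookup (fscale c f) k = c * Poly_Mapping.lookup f k"
  by (cases "Poly_Mapping.lookup f k = 0") (simp_all add: fscale_def Poly_Mapping.map.rep_eq)

lemma fscale_add: "fscale c (f + g) = fscale c f + fscale c g"
  by (rule poly_mapping_eqI) (simp add: lookup_add algebra_simps)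

lemma fscale_minus: "fscale c (f - g) = fscale c f - fscale c g"
  by (rule poly_mapping_eqI) (simp add: lookup_minus algebra_simps)

lemma fscale_add_left: "fscale (c + d) f = fscale c f + fscale d f"
  by (rule poly_mapping_eqI) (simp add: lookup_add algebra_simps)

lemma fscale_fscale [simp]: "fscale c (fscale d f) = fscale (c * d) f"
  by (rule poly_mapping_eqI) simp

lemma fscale_1 [simp]: "fscale 1 f = f"
  by (rule poly_mapping_eqI) simp

lemma fscale_0 [simp]: "fscale 0 f = 0" "fscale c 0 = 0"
  by (rule poly_mapping_eqI, simp)+

lemma fscale_sum: "fscale c (sum f A) = (\<Sum>x\<in>A. fscale c (f x))"
  by (rule poly_mapping_eqI) (simp add: lookup_sum sum_distrib_left)

lemma lin_ext_superset:
  assumes "finite A" "Poly_Mapping.keys f \<subseteq> A"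
  shows "lin_ext \<Phi> f = (\<Sum>k\<in>A. fscale (Poly_Mapping.lookup f k) (\<Phi> k))"
  unfolding lin_ext_def using assms
  by (intro sum.mono_neutral_left) (auto simp: in_keys_iff)

lemma lin_ext_zero [simp]: "lin_ext \<Phi> 0 = 0"
  by (simp add: lin_ext_def)

lemma lin_ext_word [simp]: "lin_ext \<Phi> (word k) = \<Phi> k"
  by (simp add: lin_ext_def word_def)

lemma lin_ext_add: "lin_ext \<Phi> (f + g) = lin_ext \<Phi> f + lin_ext \<Phi> g"
proof -
  let ?A = "Poly_Mapping.keys f \<union> Poly_Mapping.keys g"
  have "finite ?A" "Poly_Mapping.keys (f + g) \<subseteq> ?A"
    using keys_add[of f g] by auto
  then show ?thesis
    by (simp add: lin_ext_superset[of ?A] lookup_add fscale_add_left sum.distrib)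
qed

lemma lin_ext_scale: "lin_ext \<Phi> (fscale c f) = fscale c (lin_ext \<Phi> f)"
proof -
  have "Poly_Mapping.keys (fscale c f) \<subseteq> Poly_Mapping.keys f"
    by (auto simp: in_keys_iff)
  then show ?thesis
    by (simp add: lin_ext_superset[of "Poly_Mapping.keys f"] fscale_sum)
qed

lemma lin_ext_diff: "lin_ext \<Phi> (f - g) = lin_ext \<Phi> f - lin_ext \<Phi> g"
  using lin_ext_add[of \<Phi> "f - g" g] by simp

lemma lookup_lin_ext:
  "Poly_Mapping.lookup (lin_ext \<Phi> f) m =
   (\<Sum>k\<in>Poly_Mapping.keys f. Poly_Mapping.lookup f k * Poly_Mapping.lookup (\<Phi> k) m)"
  by (simp add: lin_ext_def lookup_sum)

lemma lin_ext_fun_add: "lin_ext (\<lambda>k. \<Phi> k + \<Psi> k) f = lin_ext \<Phi> f + lin_ext \<Psi> f"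
  by (simp add: lin_ext_def fscale_add sum.distrib)

lemma lin_ext_fun_scale: "lin_ext (\<lambda>k. fscale c (\<Phi> k)) f = fscale c (lin_ext \<Phi> f)"
  by (simp add: lin_ext_def fscale_sum mult.commute)

lemma ftensor_zero [simp]: "ftensor 0 g = 0" "ftensor f 0 = 0"
  by (simp_all add: ftensor_def lin_ext_def)

lemma ftensor_word [simp]: "ftensor (word k) (word l) = word (k, l)"
  by (simp add: ftensor_def)

lemma ftensor_add_left: "ftensor (f + f') g = ftensor f g + ftensor f' g"
  by (simp add: ftensor_def lin_ext_add)

lemma ftensor_add_right: "ftensor f (g + g') = ftensor f g + ftensor f g'"
  by (simp add: ftensor_def lin_ext_add lin_ext_fun_add)

lemma ftensor_diff_left: "ftensor (f - f') g = ftensor f g - ftensor f' g"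
  using ftensor_add_left[of "f - f'" f' g] by simp

lemma ftensor_diff_right: "ftensor f (g - g') = ftensor f g - ftensor f g'"
  using ftensor_add_right[of f "g - g'" g'] by simp

lemma ftensor_scale_left: "ftensor (fscale c f) g = fscale c (ftensor f g)"
  by (simp add: ftensor_def lin_ext_scale)

lemma ftensor_scale_right: "ftensor f (fscale c g) = fscale c (ftensor f g)"
  by (simp add: ftensor_def lin_ext_scale lin_ext_fun_scale)

lemma fword_induct [case_names zero step]:
  assumes "P 0" "\<And>c k f. P f \<Longrightarrow> P (fscale c (word k) + f)"
  shows "P f"
proof -
  have "P (\<Sum>k\<in>A. fscale (Poly_Mapping.lookup f k) (word k))" if "finite A" for A
    using that by induction (use assms in auto)
  moreover have "(\<Sum>k\<in>Poly_Mapping.keys f. fscale (Poly_Mapping.lookup f k) (word k)) = f"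
    by (rule poly_mapping_eqI)
      (auto simp: lookup_sum word_def lookup_single when_def in_keys_iff if_distrib cong: if_cong)
  ultimately show ?thesis by (metis finite_keys)
qed

lemma cspan_add: "f \<in> cspan S \<Longrightarrow> g \<in> cspan S \<Longrightarrow> f + g \<in> cspan S"
  by (induction rule: cspan.induct) (auto simp: add.assoc intro: cspan.intros)

lemma cspan_scale: "f \<in> cspan S \<Longrightarrow> fscale c f \<in> cspan S"
  by (induction rule: cspan.induct) (auto simp: fscale_add intro: cspan.intros)

lemma cspan_base: "s \<in> S \<Longrightarrow> s \<in> cspan S"
  using cspan.step[OF _ cspan.zero, of s S 1] by simp

lemma cspan_uminus: "f \<in> cspan S \<Longrightarrow> - f \<in> cspan S"
proof -
  have "fscale (-1) f = - f" by (rule poly_mapping_eqI) simp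
  then show "f \<in> cspan S \<Longrightarrow> - f \<in> cspan S" using cspan_scale[of f S "-1"] by simp
qed

lemma cspan_diff: "f \<in> cspan S \<Longrightarrow> g \<in> cspan S \<Longrightarrow> f - g \<in> cspan S"
  using cspan_add[of f S "- g"] cspan_uminus[of g S] by simp

lemma cspan_sum: "(\<And>x. x \<in> A \<Longrightarrow> f x \<in> cspan S) \<Longrightarrow> sum f A \<in> cspan S"
  by (induction A rule: infinite_finite_induct) (auto intro: cspan.zero cspan_add)

lemma lin_ext_cspan:
  assumes "\<And>s. s \<in> S \<Longrightarrow> lin_ext \<Phi> s \<in> cspan T" and "f \<in> cspan S"
  shows "lin_ext \<Phi> f \<in> cspan T"
  using assms(2)
  by induction (auto simp: lin_ext_add lin_ext_scale intro: cspan.zero cspan_add cspan_scale assms(1))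

lemma op_tensor_ftensor: "op_tensor \<Phi> \<Psi> (ftensor f g) = ftensor (lin_ext \<Phi> f) (lin_ext \<Psi> g)"
proof (induction f rule: fword_induct)
  case (step c k f)
  have "op_tensor \<Phi> \<Psi> (ftensor (word k) g) = ftensor (\<Phi> k) (lin_ext \<Psi> g)"
    by (induction g rule: fword_induct)
      (simp_all add: op_tensor_def ftensor_add_right ftensor_scale_right lin_ext_add lin_ext_scale)
  with step show ?case
    by (simp add: op_tensor_def ftensor_add_left ftensor_scale_left lin_ext_add lin_ext_scale)
qed (simp add: op_tensor_def)

lemma sesq_ext_superset:
  assumes "finite A" "Poly_Mapping.keys f \<subseteq> A" "finite B" "Poly_Mapping.keys g \<subseteq> B"
  shows "sesq_ext K f g =
    (\<Sum>k\<in>A. \<Sum>l\<in>B. cnj (Poly_Mapping.lookup f k) * Poly_Mapping.lookup g l * K k l)"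
proof -
  have "(\<Sum>l\<in>Poly_Mapping.keys g. cnj (Poly_Mapping.lookup f k) * Poly_Mapping.lookup g l * K k l)
      = (\<Sum>l\<in>B. cnj (Poly_Mapping.lookup f k) * Poly_Mapping.lookup g l * K k l)" for k
    using assms by (intro sum.mono_neutral_left) (auto simp: in_keys_iff)
  then show ?thesis
    unfolding sesq_ext_def using assms
    by (simp, intro sum.mono_neutral_left) (auto simp: in_keys_iff)
qed

lemma sesq_ext_word [simp]: "sesq_ext K (word k) (word l) = K k l"
  by (simp add: sesq_ext_def word_def)

lemma sesq_ext_add_right: "sesq_ext K f (g + h) = sesq_ext K f g + sesq_ext K f h"
proof -
  let ?B = "Poly_Mapping.keys g \<union> Poly_Mapping.keys h" and ?A = "Poly_Mapping.keys f"
  have "finite ?B" "finite ?A" "Poly_Mapping.keys (g + h) \<subseteq> ?B"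
    using keys_add[of g h] by auto
  then show ?thesis
    by (simp add: sesq_ext_superset[of ?A _ ?B] lookup_add algebra_simps sum.distrib)
qed

lemma sesq_ext_scale_right: "sesq_ext K f (fscale c g) = c * sesq_ext K f g"
proof -
  let ?B = "Poly_Mapping.keys g" and ?A = "Poly_Mapping.keys f"
  have "Poly_Mapping.keys (fscale c g) \<subseteq> ?B"
    by (auto simp: in_keys_iff)
  then show ?thesis
    by (simp add: sesq_ext_superset[of ?A _ ?B] sum_distrib_left mult.left_commute mult.assoc)
qed

lemma sesq_ext_zero [simp]: "sesq_ext K 0 g = 0" "sesq_ext K f 0 = 0"
  by (simp_all add: sesq_ext_def)

lemma sesq_ext_diff_right: "sesq_ext K f (g - h) = sesq_ext K f g - sesq_ext K f h"
  using sesq_ext_add_right[of K f "g - h" h] by simp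

lemma sesq_ext_commute:
  assumes "\<And>k l. K k l = cnj (K l k)"
  shows "sesq_ext K f g = cnj (sesq_ext K g f)"
  unfolding sesq_ext_def
  by (subst sum.swap) (simp add: assms[symmetric] mult.commute mult.left_commute)

lemma sesq_ext_add_left: "sesq_ext K (f + h) g = sesq_ext K f g + sesq_ext K h g"
proof -
  let ?A = "Poly_Mapping.keys f \<union> Poly_Mapping.keys h" and ?B = "Poly_Mapping.keys g"
  have "finite ?B" "finite ?A" "Poly_Mapping.keys (f + h) \<subseteq> ?A"
    using keys_add[of f h] by auto
  then show ?thesis
    by (simp add: sesq_ext_superset[of ?A _ ?B] lookup_add algebra_simps sum.distrib)
qed

lemma sesq_ext_scale_left: "sesq_ext K (fscale c f) g = cnj c * sesq_ext K f g"
proof -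
  let ?B = "Poly_Mapping.keys g" and ?A = "Poly_Mapping.keys f"
  have "Poly_Mapping.keys (fscale c f) \<subseteq> ?A"
    by (auto simp: in_keys_iff)
  then show ?thesis
    by (simp add: sesq_ext_superset[of ?A _ ?B] sum_distrib_left mult.left_commute mult.assoc)
qed

lemma sesq_ext_cspan:
  assumes "\<And>k s. s \<in> S \<Longrightarrow> sesq_ext K (word k) s = 0" and "g \<in> cspan S"
  shows "sesq_ext K f g = 0"
proof -
  have *: "sesq_ext K f s = 0" if "s \<in> S" for s
    by (induction f rule: fword_induct)
      (simp_all add: sesq_ext_add_left sesq_ext_scale_left assms(1)[OF that])
  show ?thesis
    using assms(2) by induction (simp_all add: sesq_ext_add_right sesq_ext_scale_right *)
qed


section \<open>Operators on pure tensors of one factor\<close>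

definition create :: "'a::real_inner \<Rightarrow> 'a complexification list \<Rightarrow> ('a complexification list \<Rightarrow>\<^sub>0 complex)" where
  "create \<xi> us = word (cplx \<xi> # us)"

text \<open>Positions in a list are counted from 0, so the exponents \<open>i - 1\<close> and \<open>n - i\<close>
  of the 1-based formula become \<open>i\<close> and \<open>n - 1 - i\<close>.\<close>

definition annihilate ::
  "real \<Rightarrow> real \<Rightarrow> 'a::real_inner \<Rightarrow> 'a complexification list \<Rightarrow> ('a complexification list \<Rightarrow>\<^sub>0 complex)" where
  "annihilate q t \<xi> us = (\<Sum>i<length us.
     fscale (complex_of_real (q ^ i * t ^ (length us - 1 - i)) * cinner (cplx \<xi>) (us ! i))
            (word (take i us @ drop (Suc i) us)))"

definition inversions :: "nat \<Rightarrow> (nat \<Rightarrow> nat) \<Rightarrow> nat" where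
  "inversions n \<sigma> = card {(i, j). i < j \<and> j < n \<and> \<sigma> i > \<sigma> j}"

definition sym_op ::
  "real \<Rightarrow> real \<Rightarrow> 'a complexification list \<Rightarrow> ('a complexification list \<Rightarrow>\<^sub>0 complex)" where
  "sym_op q t us = (\<Sum>\<sigma> | \<sigma> permutes {..<length us}.
     fscale (complex_of_real (q ^ inversions (length us) \<sigma> *
                              t ^ ((length us choose 2) - inversions (length us) \<sigma>)))
            (word (permute_list \<sigma> us)))"

definition word_inner ::
  "'a::real_inner complexification list \<Rightarrow> 'a complexification list \<Rightarrow> complex" where
  "word_inner us vs =
     (if length us = length vs then \<Prod>i<length us. cinner (us ! i) (vs ! i) else 0)"


section \<open>The algebraic diagonal Fock space\<close>

definition multilinear_rels :: "('a::real_vector complexification list \<Rightarrow>\<^sub>0 complex) set" where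
  "multilinear_rels =
     {word (us[k := cscale c x + y]) - (fscale c (word (us[k := x])) + word (us[k := y])) |
      us k c x y. k < length us}"

definition tensor_rels ::
  "('a::real_vector complexification list \<times> 'b::real_vector complexification list \<Rightarrow>\<^sub>0 complex) set" where
  "tensor_rels = {ftensor r (word vs) | r vs. r \<in> multilinear_rels} \<union>
                 {ftensor (word us) r | us r. r \<in> multilinear_rels}"

definition diagonal ::
  "('a list \<times> 'b list \<Rightarrow>\<^sub>0 complex) \<Rightarrow> bool" where
  "diagonal f \<longleftrightarrow> (\<forall>(us, vs)\<in>Poly_Mapping.keys f. length us = length vs)"

definition fdig_rel ::
  "('a::real_vector complexification list \<times> 'b::real_vector complexification list \<Rightarrow>\<^sub>0 complex) \<Rightarrow>
   ('a complexification list \<times> 'b complexification list \<Rightarrow>\<^sub>0 complex) \<Rightarrow> bool" where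
  "fdig_rel f g \<longleftrightarrow> diagonal f \<and> diagonal g \<and> f - g \<in> cspan tensor_rels"

lemma diagonal_zero [simp]: "diagonal 0"
  by (simp add: diagonal_def)

lemma diagonal_word [simp]: "diagonal (word (us, vs)) \<longleftrightarrow> length us = length vs"
  by (simp add: diagonal_def word_def)

lemma diagonal_add: "diagonal f \<Longrightarrow> diagonal g \<Longrightarrow> diagonal (f + g)"
  using keys_add[of f g] unfolding diagonal_def by blast

lemma diagonal_scale: "diagonal f \<Longrightarrow> diagonal (fscale c f)"
  unfolding diagonal_def by (auto simp: in_keys_iff)

lemma diagonal_uminus: "diagonal f \<Longrightarrow> diagonal (- f)"
  unfolding diagonal_def by (auto simp: in_keys_iff)

lemma diagonal_diff: "diagonal f \<Longrightarrow> diagonal g \<Longrightarrow> diagonal (f - g)"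
  using diagonal_add[of f "- g"] diagonal_uminus[of g] by simp

lemma diagonal_sum: "(\<And>x. x \<in> A \<Longrightarrow> diagonal (f x)) \<Longrightarrow> diagonal (sum f A)"
  by (induction A rule: infinite_finite_induct) (auto intro: diagonal_add)

lemma fdig_rel_part_equivp:
  "part_equivp (fdig_rel ::
     ('a::real_vector complexification list \<times> 'b::real_vector complexification list \<Rightarrow>\<^sub>0 complex) \<Rightarrow> _)"
proof (rule part_equivpI)
  show "\<exists>f :: 'a complexification list \<times> 'b complexification list \<Rightarrow>\<^sub>0 complex. fdig_rel f f"
    by (rule exI[of _ 0]) (simp add: fdig_rel_def cspan.zero)
  have "fdig_rel g f" if "fdig_rel f g" for f g :: "'a complexification list \<times> 'b complexification list \<Rightarrow>\<^sub>0 complex"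
    using that cspan_uminus[of "f - g"] by (simp add: fdig_rel_def)
  then show "symp (fdig_rel :: _ \<Rightarrow> ('a complexification list \<times> 'b complexification list \<Rightarrow>\<^sub>0 complex) \<Rightarrow> _)"
    by (simp add: symp_def)
  have "fdig_rel f h" if "fdig_rel f g" "fdig_rel g h"
    for f g h :: "'a complexification list \<times> 'b complexification list \<Rightarrow>\<^sub>0 complex"
    using that cspan_add[of "f - g" _ "g - h"] by (simp add: fdig_rel_def)
  then show "transp (fdig_rel :: _ \<Rightarrow> ('a complexification list \<times> 'b complexification list \<Rightarrow>\<^sub>0 complex) \<Rightarrow> _)"
    unfolding transp_def by blast
qed

text \<open>
  The direct sum over all \<open>n\<close> of (\<open>n\<close>-th tensor power of the complexification of \<open>'a\<close>) tensor
  (\<open>n\<close>-th tensor power of the complexification of \<open>'b\<close>): formal combinations of pairs of words of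
  equal length, modulo multilinearity in every slot.
\<close>

quotient_type (overloaded) ('a, 'b) fdig =
  "'a::real_inner complexification list \<times> 'b::real_inner complexification list \<Rightarrow>\<^sub>0 complex" /
  partial: fdig_rel
  by (rule fdig_rel_part_equivp)

lemma tensor_relsI:
  "r \<in> multilinear_rels \<Longrightarrow> ftensor r (word vs) \<in> tensor_rels"
  "r' \<in> multilinear_rels \<Longrightarrow> ftensor (word us) r' \<in> tensor_rels"
  unfolding tensor_rels_def by blast+

lemma ftensor_rels_left:
  assumes "f \<in> cspan multilinear_rels" shows "ftensor f g \<in> cspan tensor_rels"
  using assms
proof induction
  case (step s f c)
  have "ftensor s g \<in> cspan tensor_rels"
    by (induction g rule: fword_induct)
      (use step(1) in \<open>simp_all add: ftensor_add_right ftensor_scale_right cspan.zero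
        cspan.step tensor_relsI\<close>)
  with step show ?case by (simp add: ftensor_add_left ftensor_scale_left cspan_add cspan_scale)
qed (simp add: cspan.zero)

lemma ftensor_rels_right:
  assumes "g \<in> cspan multilinear_rels" shows "ftensor f g \<in> cspan tensor_rels"
  using assms
proof induction
  case (step s g c)
  have "ftensor f s \<in> cspan tensor_rels"
    by (induction f rule: fword_induct)
      (use step(1) in \<open>simp_all add: ftensor_add_left ftensor_scale_left cspan.zero
        cspan.step tensor_relsI\<close>)
  with step show ?case by (simp add: ftensor_add_right ftensor_scale_right cspan_add cspan_scale)
qed (simp add: cspan.zero)

lemma op_tensor_rels:
  assumes "\<And>r. r \<in> multilinear_rels \<Longrightarrow> lin_ext \<Phi> r \<in> cspan multilinear_rels"
    and "\<And>r. r \<in> multilinear_rels \<Longrightarrow> lin_ext \<Psi> r \<in> cspan multilinear_rels"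
    and "f \<in> cspan tensor_rels"
  shows "op_tensor \<Phi> \<Psi> f \<in> cspan tensor_rels"
proof -
  have "lin_ext (\<lambda>(k, l). ftensor (\<Phi> k) (\<Psi> l)) s \<in> cspan tensor_rels" if s: "s \<in> tensor_rels" for s
  proof -
    have "op_tensor \<Phi> \<Psi> s \<in> cspan tensor_rels"
    proof -
      consider (l) r vs where "s = ftensor r (word vs)" "r \<in> multilinear_rels"
        | (r) us r where "s = ftensor (word us) r" "r \<in> multilinear_rels"
        using s unfolding tensor_rels_def by blast
      then show ?thesis
        by cases (simp_all add: op_tensor_ftensor ftensor_rels_left ftensor_rels_right assms(1,2))
    qed
    then show ?thesis by (simp only: op_tensor_def)
  qed
  then show ?thesis
    unfolding op_tensor_def using assms(3) by (rule lin_ext_cspan)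
qed

lemma multilinear_relI:
  "k < length us \<Longrightarrow>
   word (us[k := cscale c x + y]) - (fscale c (word (us[k := x])) + word (us[k := y]))
     \<in> cspan multilinear_rels"
  unfolding multilinear_rels_def by (rule cspan_base) blast

lemma create_rels:
  assumes "r \<in> multilinear_rels" shows "lin_ext (create \<xi>) r \<in> cspan multilinear_rels"
proof -
  obtain us k c x y where k: "k < length us" and
    r: "r = word (us[k := cscale c x + y]) - (fscale c (word (us[k := x])) + word (us[k := y]))"
    using assms unfolding multilinear_rels_def by blast
  show ?thesis
    using multilinear_relI[of "Suc k" "cplx \<xi> # us" c x y] k
    by (simp add: r lin_ext_diff lin_ext_add lin_ext_scale create_def)
qed

lemma sym_op_rels:
  assumes "r \<in> multilinear_rels" shows "lin_ext (sym_op q t) r \<in> cspan multilinear_rels"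
proof -
  obtain us k c x y where k: "k < length us" and
    r: "r = word (us[k := cscale c x + y]) - (fscale c (word (us[k := x])) + word (us[k := y]))"
    using assms unfolding multilinear_rels_def by blast
  define C where "C \<sigma> = complex_of_real (q ^ inversions (length us) \<sigma> *
                              t ^ ((length us choose 2) - inversions (length us) \<sigma>))" for \<sigma>
  have p: "permute_list \<sigma> (us[k := z]) = (permute_list \<sigma> us)[inv \<sigma> k := z]"
    if "\<sigma> permutes {..<length us}" for \<sigma> z
  proof (rule nth_equalityI)
    fix i assume "i < length (permute_list \<sigma> (us[k := z]))"
    then have i: "i < length us" by simp
    have "\<sigma> i < length us" using permutes_in_image[OF that, of i] i by simp
    moreover have "inv \<sigma> k = i \<longleftrightarrow> k = \<sigma> i" using that permutes_inv_eq by metis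
    ultimately show "permute_list \<sigma> (us[k := z]) ! i = (permute_list \<sigma> us)[inv \<sigma> k := z] ! i"
      using i that k by (auto simp: permute_list_nth nth_list_update)
  qed simp
  have S: "sym_op q t (us[k := z]) = (\<Sum>\<sigma> | \<sigma> permutes {..<length us}.
     fscale (C \<sigma>) (word ((permute_list \<sigma> us)[inv \<sigma> k := z])))" for z
    unfolding sym_op_def by (rule sum.cong) (auto simp: p C_def)
  have "lin_ext (sym_op q t) r = (\<Sum>\<sigma> | \<sigma> permutes {..<length us}. fscale (C \<sigma>)
      (word ((permute_list \<sigma> us)[inv \<sigma> k := cscale c x + y]) -
       (fscale c (word ((permute_list \<sigma> us)[inv \<sigma> k := x])) + word ((permute_list \<sigma> us)[inv \<sigma> k := y]))))"
    by (simp add: r lin_ext_diff lin_ext_add lin_ext_scale S fscale_sum fscale_minus fscale_add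
        mult.commute sum.distrib sum_subtractf)
  also have "\<dots> \<in> cspan multilinear_rels"
  proof (intro cspan_sum cspan_scale multilinear_relI)
    fix \<sigma> assume "\<sigma> \<in> {\<sigma>. \<sigma> permutes {..<length us}}"
    then have "inv \<sigma> k < length us"
      using k permutes_in_image[OF permutes_inv, of \<sigma> "{..<length us}" k] by simp
    then show "inv \<sigma> k < length (permute_list \<sigma> us)" by simp
  qed
  finally show ?thesis .
qed

lemma annihilate_rels:
  assumes "r \<in> multilinear_rels" shows "lin_ext (annihilate q t \<xi>) r \<in> cspan multilinear_rels"
proof -
  obtain us k c x y where k: "k < length us" and
    r: "r = word (us[k := cscale c x + y]) - (fscale c (word (us[k := x])) + word (us[k := y]))"
    using assms unfolding multilinear_rels_def by blast
  define R where "R i z = fscale (complex_of_real (q ^ i * t ^ (length us - 1 - i)) *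
      cinner (cplx \<xi>) (us[k := z] ! i))
            (word (take i (us[k := z]) @ drop (Suc i) (us[k := z])))" for i z
  have "lin_ext (annihilate q t \<xi>) r =
      (\<Sum>i<length us. R i (cscale c x + y) - (fscale c (R i x) + R i y))"
    by (simp add: r lin_ext_diff lin_ext_add lin_ext_scale annihilate_def R_def fscale_sum
        sum.distrib sum_subtractf)
  also have "\<dots> \<in> cspan multilinear_rels"
  proof (rule cspan_sum)
    fix i assume "i \<in> {..<length us}"
    then have i: "i < length us" by simp
    show "R i (cscale c x + y) - (fscale c (R i x) + R i y) \<in> cspan multilinear_rels"
    proof (cases "i = k")
      case True
      have "R i (cscale c x + y) - (fscale c (R i x) + R i y) = 0"
        using k unfolding R_def True
        by (simp add: cinner_add_right cinner_scale_right algebra_simps flip: fscale_add_left)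
      then show ?thesis by (simp only: cspan.zero)
    next
      case False
      define ws where "ws = take i us @ drop (Suc i) us"
      define k' where "k' = (if k < i then k else k - 1)"
      define C where "C = complex_of_real (q ^ i * t ^ (length us - 1 - i)) * cinner (cplx \<xi>) (us ! i)"
      have k': "k' < length ws" using k i False by (auto simp: ws_def k'_def)
      have "take i (us[k := z]) @ drop (Suc i) (us[k := z]) = ws[k' := z]" for z
        using False i k unfolding ws_def k'_def
        by (cases "k < i") (auto simp: list_update_append drop_update_swap take_update_swap list_update_beyond)
      then have "R i z = fscale C (word (ws[k' := z]))" for z
        using False by (simp add: R_def C_def)
      then have "R i (cscale c x + y) - (fscale c (R i x) + R i y) = fscale C
         (word (ws[k' := cscale c x + y]) - (fscale c (word (ws[k' := x])) + word (ws[k' := y])))"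
        by (simp add: fscale_minus fscale_add mult.commute)
      then show ?thesis using cspan_scale[OF multilinear_relI[OF k']] by simp
    qed
  qed
  finally show ?thesis .
qed

lemma op_tensor_diagonal:
  assumes "\<And>us vs. length us = length vs \<Longrightarrow> diagonal (ftensor (\<Phi> us) (\<Psi> vs))" and "diagonal f"
  shows "diagonal (op_tensor \<Phi> \<Psi> f)"
  unfolding op_tensor_def lin_ext_def
  using assms by (auto intro!: diagonal_sum diagonal_scale simp: diagonal_def[of f])

lemma ftensor_sum_left: "ftensor (sum f A) g = (\<Sum>x\<in>A. ftensor (f x) g)"
  by (induction A rule: infinite_finite_induct) (simp_all add: ftensor_add_left)

lemma ftensor_sum_right: "ftensor f (sum g A) = (\<Sum>x\<in>A. ftensor f (g x))"
  by (induction A rule: infinite_finite_induct) (simp_all add: ftensor_add_right)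

lemma fdig_rel_op_tensor:
  assumes "\<And>r. r \<in> multilinear_rels \<Longrightarrow> lin_ext \<Phi> r \<in> cspan multilinear_rels"
    and "\<And>r. r \<in> multilinear_rels \<Longrightarrow> lin_ext \<Psi> r \<in> cspan multilinear_rels"
    and "\<And>us vs. length us = length vs \<Longrightarrow> diagonal (ftensor (\<Phi> us) (\<Psi> vs))"
    and "fdig_rel f g"
  shows "fdig_rel (op_tensor \<Phi> \<Psi> f) (op_tensor \<Phi> \<Psi> g)"
  using assms(4) op_tensor_rels[of \<Phi> \<Psi> "f - g", OF assms(1,2)]
    op_tensor_diagonal[of \<Phi> \<Psi>, OF assms(3)]
  by (auto simp: fdig_rel_def op_tensor_def lin_ext_diff)

instantiation fdig :: (real_inner, real_inner) ab_group_add
begin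

lift_definition zero_fdig :: "('a, 'b) fdig" is 0
  by (simp add: fdig_rel_def cspan.zero)

lift_definition plus_fdig :: "('a, 'b) fdig \<Rightarrow> ('a, 'b) fdig \<Rightarrow> ('a, 'b) fdig" is "(+)"
  by (auto simp: fdig_rel_def add_diff_add intro: diagonal_add cspan_add)

lift_definition uminus_fdig :: "('a, 'b) fdig \<Rightarrow> ('a, 'b) fdig" is uminus
proof -
  fix f f' :: "'a complexification list \<times> 'b complexification list \<Rightarrow>\<^sub>0 complex"
  assume "fdig_rel f f'"
  then show "fdig_rel (- f) (- f')"
    using cspan_uminus[of "f - f'"] by (simp add: fdig_rel_def diagonal_uminus)
qed

lift_definition minus_fdig :: "('a, 'b) fdig \<Rightarrow> ('a, 'b) fdig \<Rightarrow> ('a, 'b) fdig" is "(-)"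
proof -
  fix f f' g g' :: "'a complexification list \<times> 'b complexification list \<Rightarrow>\<^sub>0 complex"
  assume "fdig_rel f f'" "fdig_rel g g'"
  moreover have "f - g - (f' - g') = (f - f') - (g - g')" by simp
  ultimately show "fdig_rel (f - g) (f' - g')"
    using cspan_diff[of "f - f'" tensor_rels "g - g'"] by (simp only: fdig_rel_def diagonal_diff)
qed

instance
proof
  fix a b c :: "('a, 'b) fdig"
  show "a + b + c = a + (b + c)"
    by transfer (auto simp: fdig_rel_def add.assoc intro: diagonal_add cspan.zero)
  show "a + b = b + a"
    by transfer (auto simp: fdig_rel_def intro: diagonal_add cspan.zero)
  show "0 + a = a"
    by transfer (auto simp: fdig_rel_def intro: cspan.zero)
  show "- a + a = 0"
    by transfer (auto simp: fdig_rel_def intro: cspan.zero)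
  show "a - b = a + - b"
    by transfer (auto simp: fdig_rel_def intro: diagonal_diff cspan.zero)
qed

end

lift_definition scale_fdig :: "complex \<Rightarrow> ('a::real_inner, 'b::real_inner) fdig \<Rightarrow> ('a, 'b) fdig" is fscale
proof -
  fix c and f f' :: "'a complexification list \<times> 'b complexification list \<Rightarrow>\<^sub>0 complex"
  assume "fdig_rel f f'"
  then show "fdig_rel (fscale c f) (fscale c f')"
    using cspan_scale[of "f - f'" _ c] by (simp add: fdig_rel_def diagonal_scale fscale_minus)
qed

text \<open>
  The tensor product of \<open>x\<^sub>1 \<otimes> \<dots> \<otimes> x\<^sub>n\<close> and \<open>y\<^sub>1 \<otimes> \<dots> \<otimes> y\<^sub>n\<close>; it is used only to
  describe the operators below.
\<close>

lift_definition pure_tensor ::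
  "'a::real_inner complexification list \<Rightarrow> 'b::real_inner complexification list \<Rightarrow> ('a, 'b) fdig"
  is "\<lambda>us vs. if length us = length vs then word (us, vs) else 0"
  by (simp add: fdig_rel_def cspan.zero)

lift_definition vacuum :: "('a::real_inner, 'b::real_inner) fdig" is "word ([], [])"
  by (simp add: fdig_rel_def cspan.zero)

lift_definition A_star ::
  "'a::real_inner \<Rightarrow> 'b::real_inner \<Rightarrow> ('a, 'b) fdig \<Rightarrow> ('a, 'b) fdig"
  is "\<lambda>\<xi> \<eta>. op_tensor (create \<xi>) (create \<eta>)"
  by (rule fdig_rel_op_tensor) (auto intro: create_rels simp: create_def)

lift_definition A_op ::
  "real \<Rightarrow> real \<Rightarrow> real \<Rightarrow> real \<Rightarrow> 'a::real_inner \<Rightarrow> 'b::real_inner \<Rightarrow> ('a, 'b) fdig \<Rightarrow> ('a, 'b) fdig"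
  is "\<lambda>q t v w \<xi> \<eta>. op_tensor (annihilate q t \<xi>) (annihilate v w \<eta>)"
  by (rule fdig_rel_op_tensor)
    (auto intro!: annihilate_rels diagonal_sum diagonal_scale
      simp: annihilate_def ftensor_sum_left ftensor_sum_right ftensor_scale_left ftensor_scale_right)

definition G_op ::
  "real \<Rightarrow> real \<Rightarrow> real \<Rightarrow> real \<Rightarrow> 'a::real_inner \<Rightarrow> 'b::real_inner \<Rightarrow> ('a, 'b) fdig \<Rightarrow> ('a, 'b) fdig" where
  "G_op q t v w \<xi> \<eta> f = A_op q t v w \<xi> \<eta> f + A_star \<xi> \<eta> f"

text \<open>The operator acting as \<open>P\<^sup>(\<^sup>n\<^sup>)\<^sub>q\<^sub>,\<^sub>t \<otimes> P\<^sup>(\<^sup>n\<^sup>)\<^sub>v\<^sub>,\<^sub>w\<close> in every degree \<open>n\<close>.\<close>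

lift_definition P_op ::
  "real \<Rightarrow> real \<Rightarrow> real \<Rightarrow> real \<Rightarrow> ('a::real_inner, 'b::real_inner) fdig \<Rightarrow> ('a, 'b) fdig"
  is "\<lambda>q t v w. op_tensor (sym_op q t) (sym_op v w)"
  by (rule fdig_rel_op_tensor)
    (auto intro!: sym_op_rels diagonal_sum diagonal_scale
      simp: sym_op_def ftensor_sum_left ftensor_sum_right ftensor_scale_left ftensor_scale_right)

definition pair_inner ::
  "'a::real_inner complexification list \<times> 'b::real_inner complexification list \<Rightarrow>
   'a complexification list \<times> 'b complexification list \<Rightarrow> complex" where
  "pair_inner p p' = word_inner (fst p) (fst p') * word_inner (snd p) (snd p')"

lemma word_inner_commute: "word_inner us vs = cnj (word_inner vs us)"
  by (auto simp: word_inner_def cinner_commute[symmetric])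

lemma pair_inner_commute: "pair_inner p p' = cnj (pair_inner p' p)"
  by (simp add: pair_inner_def word_inner_commute[symmetric])

lemma word_inner_update:
  assumes "k < length us"
  shows "word_inner ws (us[k := cscale c x + y]) =
    c * word_inner ws (us[k := x]) + word_inner ws (us[k := y])"
proof (cases "length ws = length us")
  case True
  let ?K = "{..<length us} - {k}"
  have "word_inner ws (us[k := z]) = cinner (ws ! k) z * (\<Prod>i\<in>?K. cinner (ws ! i) (us ! i))" for z
  proof -
    have "word_inner ws (us[k := z]) = (\<Prod>i<length us. cinner (ws ! i) (us[k := z] ! i))"
      by (simp add: word_inner_def True)
    also have "\<dots> = cinner (ws ! k) (us[k := z] ! k) * (\<Prod>i\<in>?K. cinner (ws ! i) (us[k := z] ! i))"
      using assms by (intro prod.remove) auto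
    also have "(\<Prod>i\<in>?K. cinner (ws ! i) (us[k := z] ! i)) = (\<Prod>i\<in>?K. cinner (ws ! i) (us ! i))"
      by (rule prod.cong) auto
    finally show ?thesis using assms by simp
  qed
  then show ?thesis by (simp add: cinner_add_right cinner_scale_right algebra_simps)
qed (simp add: word_inner_def)

lemma pair_inner_rels:
  assumes "s \<in> tensor_rels" shows "sesq_ext pair_inner (word p) s = 0"
proof -
  consider (l) us k c x y vs where "k < length us" "s = ftensor (word (us[k := cscale c x + y]) -
        (fscale c (word (us[k := x])) + word (us[k := y]))) (word vs)"
    | (r) us k c x y vs where "k < length us" "s = ftensor (word vs) (word (us[k := cscale c x + y]) -
        (fscale c (word (us[k := x])) + word (us[k := y])))"
    using assms unfolding tensor_rels_def multilinear_rels_def by blast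
  then show ?thesis
    by cases
      (simp_all add: ftensor_diff_left ftensor_diff_right ftensor_add_left ftensor_add_right
        ftensor_scale_left ftensor_scale_right pair_inner_def sesq_ext_diff_right
        sesq_ext_add_right sesq_ext_scale_right word_inner_update ring_distribs mult_ac)
qed

text \<open>The inner product of the algebraic Fock space before deformation.\<close>

lift_definition free_inner :: "('a::real_inner, 'b::real_inner) fdig \<Rightarrow> ('a, 'b) fdig \<Rightarrow> complex"
  is "sesq_ext pair_inner"
proof -
  fix f f' g g' :: "'a complexification list \<times> 'b complexification list \<Rightarrow>\<^sub>0 complex"
  assume fg: "fdig_rel f f'" "fdig_rel g g'"
  have *: "sesq_ext pair_inner h k = sesq_ext pair_inner h k'" if "fdig_rel k k'"
    for h k k' :: "'a complexification list \<times> 'b complexification list \<Rightarrow>\<^sub>0 complex"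
  proof -
    have "sesq_ext pair_inner h (k - k') = 0"
      using sesq_ext_cspan[of tensor_rels pair_inner "k - k'" h] pair_inner_rels that
      by (auto simp: fdig_rel_def)
    then show ?thesis by (simp add: sesq_ext_diff_right)
  qed
  have "sesq_ext pair_inner f g = sesq_ext pair_inner f g'"
    using fg by (intro *)
  also have "\<dots> = cnj (sesq_ext pair_inner g' f)"
    by (rule sesq_ext_commute) (rule pair_inner_commute)
  also have "\<dots> = cnj (sesq_ext pair_inner g' f')"
    using *[OF fg(1)] by simp
  also have "\<dots> = sesq_ext pair_inner f' g'"
    by (rule sesq_ext_commute[symmetric]) (rule pair_inner_commute)
  finally show "sesq_ext pair_inner f g = sesq_ext pair_inner f' g'" .
qed

definition fock_inner ::
  "real \<Rightarrow> real \<Rightarrow> real \<Rightarrow> real \<Rightarrow> ('a::real_inner, 'b::real_inner) fdig \<Rightarrow> ('a, 'b) fdig \<Rightarrow> complex" where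
  "fock_inner q t v w f g = free_inner f (P_op q t v w g)"

definition vacuum_state ::
  "real \<Rightarrow> real \<Rightarrow> real \<Rightarrow> real \<Rightarrow> (('a::real_inner, 'b::real_inner) fdig \<Rightarrow> ('a, 'b) fdig) \<Rightarrow> complex" where
  "vacuum_state q t v w T = fock_inner q t v w vacuum (T vacuum)"

text \<open>\<open>G_prod q t v w \<xi> \<eta> n\<close> is the composition of the operators with indices \<open>1, \<dots>, n\<close>,
  the one with index \<open>n\<close> being applied first.\<close>

definition G_prod ::
  "real \<Rightarrow> real \<Rightarrow> real \<Rightarrow> real \<Rightarrow> (nat \<Rightarrow> 'a::real_inner) \<Rightarrow> (nat \<Rightarrow> 'b::real_inner) \<Rightarrow> nat \<Rightarrow>
   ('a, 'b) fdig \<Rightarrow> ('a, 'b) fdig" where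
  "G_prod q t v w \<xi> \<eta> n = foldr (\<circ>) (map (\<lambda>i. G_op q t v w (\<xi> i) (\<eta> i)) [1..<n + 1]) id"


subsection \<open>The operators on pure tensors\<close>

lemma fdig_relI: "diagonal f \<Longrightarrow> f = g \<Longrightarrow> fdig_rel f g"
  by (simp add: fdig_rel_def cspan.zero)

lemma pure_tensor_linear_left:
  fixes us :: "'a::real_inner complexification list" and vs :: "'b::real_inner complexification list"
  assumes "k < length us" "length us = length vs"
  shows "pure_tensor (us[k := cscale c x + y]) vs =
    scale_fdig c (pure_tensor (us[k := x]) vs) + pure_tensor (us[k := y]) vs"
  using assms
proof (transfer fixing: k c)
  fix us :: "'a complexification list" and x y and vs :: "'b complexification list"
  assume "k < length us" "length us = length vs"
  then show "fdig_rel (if length (us[k := cscale c x + y]) = length vs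
        then word (us[k := cscale c x + y], vs) else 0)
     (fscale c (if length (us[k := x]) = length vs then word (us[k := x], vs) else 0) +
      (if length (us[k := y]) = length vs then word (us[k := y], vs) else 0))"
    using ftensor_rels_left[OF multilinear_relI[of k us c x y], of "word vs"]
    by (simp add: fdig_rel_def ftensor_diff_left ftensor_add_left ftensor_scale_left
        diagonal_add diagonal_scale)
qed

lemma pure_tensor_linear_right:
  fixes us :: "'a::real_inner complexification list" and vs :: "'b::real_inner complexification list"
  assumes "k < length vs" "length us = length vs"
  shows "pure_tensor us (vs[k := cscale c x + y]) =
    scale_fdig c (pure_tensor us (vs[k := x])) + pure_tensor us (vs[k := y])"
  using assms
proof (transfer fixing: k c)
  fix vs :: "'b complexification list" and x y and us :: "'a complexification list"
  assume "k < length vs" "length us = length vs"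
  then show "fdig_rel (if length us = length (vs[k := cscale c x + y])
        then word (us, vs[k := cscale c x + y]) else 0)
     (fscale c (if length us = length (vs[k := x]) then word (us, vs[k := x]) else 0) +
      (if length us = length (vs[k := y]) then word (us, vs[k := y]) else 0))"
    using ftensor_rels_right[OF multilinear_relI[of k vs c x y], of "word us"]
    by (simp add: fdig_rel_def ftensor_diff_right ftensor_add_right ftensor_scale_right
        diagonal_add diagonal_scale)
qed

lemma pure_tensor_Nil: "pure_tensor [] [] = vacuum"
  by transfer (simp add: fdig_relI)

lemma fdig_rel_refl: "diagonal f \<Longrightarrow> fdig_rel f f"
  by (simp add: fdig_relI)

lemma abs_fdig_sum:
  assumes "\<And>x. x \<in> A \<Longrightarrow> diagonal (f x)"
  shows "abs_fdig (sum f A) = (\<Sum>x\<in>A. abs_fdig (f x))"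
  using assms
proof (induction A rule: infinite_finite_induct)
  case (insert x A)
  then have "diagonal (f x)" "diagonal (sum f A)" by (auto intro: diagonal_sum)
  with insert show ?case by (simp add: plus_fdig.abs_eq[OF fdig_rel_refl fdig_rel_refl, symmetric])
qed (simp_all add: zero_fdig_def)

lemma pure_tensor_abs: "length us = length vs \<Longrightarrow> pure_tensor us vs = abs_fdig (word (us, vs))"
  by (simp add: pure_tensor_def)

lemma A_op_pure:
  fixes us :: "'c::real_inner complexification list" and vs :: "'d::real_inner complexification list"
  assumes len: "length us = length vs"
  shows "A_op q t v w \<xi> \<eta> (pure_tensor us vs) = (\<Sum>i<length us. \<Sum>j<length vs.
    scale_fdig (complex_of_real (q ^ i * t ^ (length us - 1 - i)) * cinner (cplx \<xi>) (us ! i) *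
                (complex_of_real (v ^ j * w ^ (length vs - 1 - j)) * cinner (cplx \<eta>) (vs ! j)))
      (pure_tensor (take i us @ drop (Suc i) us) (take j vs @ drop (Suc j) vs)))"
proof -
  define d :: "'c complexification list \<Rightarrow> nat \<Rightarrow> 'c complexification list"
    where "d ws i = take i ws @ drop (Suc i) ws" for ws i
  define e :: "'d complexification list \<Rightarrow> nat \<Rightarrow> 'd complexification list"
    where "e ws i = take i ws @ drop (Suc i) ws" for ws i
  define C where "C i j = complex_of_real (q ^ i * t ^ (length us - 1 - i)) * cinner (cplx \<xi>) (us ! i) *
                (complex_of_real (v ^ j * w ^ (length vs - 1 - j)) * cinner (cplx \<eta>) (vs ! j))" for i j
  have dl: "length (d us i) = length (e vs j)" if "i < length us" "j < length vs" for i j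
    using that len by (auto simp: d_def e_def)
  have dg: "diagonal (word (d us i, e vs j))" if "i < length us" "j < length vs" for i j
    using dl[OF that] by simp
  have "A_op q t v w \<xi> \<eta> (pure_tensor us vs) =
      abs_fdig (op_tensor (annihilate q t \<xi>) (annihilate v w \<eta>) (word (us, vs)))"
    using len by (simp add: pure_tensor_abs A_op.abs_eq fdig_rel_refl)
  also have "op_tensor (annihilate q t \<xi>) (annihilate v w \<eta>) (word (us, vs)) =
      (\<Sum>i<length us. \<Sum>j<length vs. fscale (C i j) (word (d us i, e vs j)))"
    by (simp add: op_tensor_def annihilate_def ftensor_sum_left ftensor_sum_right
        ftensor_scale_left ftensor_scale_right fscale_sum C_def d_def e_def)
      (subst sum.swap, simp add: mult_ac)
  also have "abs_fdig \<dots> = (\<Sum>i<length us. \<Sum>j<length vs. abs_fdig (fscale (C i j) (word (d us i, e vs j))))"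
    by (subst abs_fdig_sum, fastforce intro: diagonal_sum diagonal_scale dg)
      (auto intro!: sum.cong abs_fdig_sum diagonal_scale dg)
  also have "\<dots> = (\<Sum>i<length us. \<Sum>j<length vs. scale_fdig (C i j) (pure_tensor (d us i) (e vs j)))"
    by (intro sum.cong refl)
      (simp add: pure_tensor_abs dl scale_fdig.abs_eq fdig_rel_refl)
  finally show ?thesis by (simp add: C_def d_def e_def)
qed

lemma A_star_pure:
  "length us = length vs \<Longrightarrow>
   A_star \<xi> \<eta> (pure_tensor us vs) = pure_tensor (cplx \<xi> # us) (cplx \<eta> # vs)"
  by transfer (simp add: op_tensor_def create_def fdig_relI)

lemma free_inner_pure:
  "length us = length vs \<Longrightarrow> length us' = length vs' \<Longrightarrow>
   free_inner (pure_tensor us vs) (pure_tensor us' vs') = word_inner us us' * word_inner vs vs'"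
  by transfer (simp add: pair_inner_def)

lemma A_op_vacuum: "A_op q t v w \<xi> \<eta> vacuum = 0"
  by transfer (simp add: op_tensor_def annihilate_def fdig_relI)

lemma diagonal_annihilate:
  "length us = length vs \<Longrightarrow> diagonal (ftensor (annihilate q t \<xi> us) (annihilate v w \<eta> vs))"
  by (auto intro!: diagonal_sum diagonal_scale
      simp: annihilate_def ftensor_sum_left ftensor_sum_right ftensor_scale_left ftensor_scale_right)

lemma A_star_add: "A_star \<xi> \<eta> (f + g) = A_star \<xi> \<eta> f + A_star \<xi> \<eta> g"
  by transfer
    (auto intro!: fdig_relI op_tensor_diagonal diagonal_add
      simp: op_tensor_def[symmetric] create_def fdig_rel_def, simp add: op_tensor_def lin_ext_add)

lemma A_star_scale: "A_star \<xi> \<eta> (scale_fdig c f) = scale_fdig c (A_star \<xi> \<eta> f)"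
  by transfer
    (auto intro!: fdig_relI op_tensor_diagonal diagonal_scale
      simp: create_def fdig_rel_def, simp add: op_tensor_def lin_ext_scale)

lemma A_op_add: "A_op q t v w \<xi> \<eta> (f + g) = A_op q t v w \<xi> \<eta> f + A_op q t v w \<xi> \<eta> g"
  by transfer
    (auto intro!: fdig_relI op_tensor_diagonal diagonal_add diagonal_annihilate
      simp: fdig_rel_def, simp add: op_tensor_def lin_ext_add)

lemma A_op_scale: "A_op q t v w \<xi> \<eta> (scale_fdig c f) = scale_fdig c (A_op q t v w \<xi> \<eta> f)"
  by transfer
    (auto intro!: fdig_relI op_tensor_diagonal diagonal_scale diagonal_annihilate
      simp: fdig_rel_def, simp add: op_tensor_def lin_ext_scale)


section \<open>Diagonal pair partitions\<close>

text \<open>The disjoint copies of \<open>{1..n}\<close> are \<open>Inl ` {1..n}\<close> and \<open>Inr ` {1..n}\<close>.\<close>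

definition left_part :: "(nat + nat) set set \<Rightarrow> nat set set" where
  "left_part \<pi> = {B. Inl ` B \<in> \<pi>}"

definition right_part :: "(nat + nat) set set \<Rightarrow> nat set set" where
  "right_part \<pi> = {B. Inr ` B \<in> \<pi>}"

definition diag_pair_partitions :: "nat \<Rightarrow> (nat + nat) set set set" where
  "diag_pair_partitions n = {\<pi>.
     partition_on (Inl ` {1..n} \<union> Inr ` {1..n}) \<pi> \<and>
     (\<forall>B\<in>\<pi>. card B = 2 \<and> (B \<subseteq> range Inl \<or> B \<subseteq> range Inr)) \<and>
     Min ` left_part \<pi> = Min ` right_part \<pi>}"

text \<open>Each unordered pair of blocks is counted once, since the condition \<open>Min B < Min C\<close> fixes
  its order.\<close>

definition crossings :: "nat set set \<Rightarrow> nat" where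
  "crossings \<rho> = card {(B, C). B \<in> \<rho> \<and> C \<in> \<rho> \<and> Min B < Min C \<and> Min C < Max B \<and> Max B < Max C}"

definition nestings :: "nat set set \<Rightarrow> nat" where
  "nestings \<rho> = card {(B, C). B \<in> \<rho> \<and> C \<in> \<rho> \<and> Min B < Min C \<and> Min C < Max C \<and> Max C < Max B}"

end

theory Submission
  imports Defs
begin

text \<open>
  Read from right to left, a product of operators \<open>G\<close> applied to the vacuum runs through the points
  \<open>n, \<dots>, 1\<close>. Expanding every \<open>G\<close> into \<open>A\<^sup>* + A\<close> declares each point to be a closer (a creation) or
  an opener (an annihilation). At each moment the pure tensor in either leg lists the closers still
  waiting for a partner, in increasing order, and annihilating one of its factors amounts to pairing
  the current point with that closer. The waiting closers to the left of the chosen one will later be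
  joined to smaller points and so cross the new block, while those to its right will enclose it; this
  is why the two exponents in the annihilator count exactly crossings and nestings.
  The two legs choose their closers independently, but since \<open>G\<close> creates or annihilates in both legs
  at once, they share the set of openers.

  Keeping the original points as labels avoids any renumbering. For a finite set \<open>A\<close> of points and
  a set \<open>Op\<close> of openers, let \<open>pairing_sum\<close> be the weighted sum over the pair partitions of
  \<open>A\<close> with openers \<open>Op\<close>. Deleting the block of the largest opener yields the recursion
  \<open>pairing_sum_last_opener\<close>, whose coefficients are those of the annihilation operator. By induction on
  the number \<open>k\<close> of operators left, \<open>vacuum_coeff_pure\<close> shows that their vacuum coefficient on a pure
  tensor labelled by waiting closers in each leg is the sum over \<open>Op \<subseteq> {1..k}\<close> of the product of two
  such sums. For \<open>k = n\<close> and no waiting closers, pairs of pair partitions with common openers are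
  exactly the diagonal pair partitions (\<open>sum_diag_pair_partitions\<close>).
  Since the degree-zero component of the deformation is the identity and distinct degrees are
  orthogonal, the deformed inner product with the vacuum merely extracts the vacuum coefficient.
\<close>

section \<open>Pair partitions with a prescribed set of openers\<close>

definition pairings :: "nat set \<Rightarrow> nat set \<Rightarrow> nat set set set" where
  "pairings A Op = {\<rho>. partition_on A \<rho> \<and> (\<forall>B\<in>\<rho>. card B = 2) \<and> Min ` \<rho> = Op}"

definition weight :: "real \<Rightarrow> real \<Rightarrow> (nat \<Rightarrow> nat \<Rightarrow> complex) \<Rightarrow> nat set set \<Rightarrow> complex" where
  "weight q t g \<rho> = complex_of_real (q ^ crossings \<rho> * t ^ nestings \<rho>) * (\<Prod>B\<in>\<rho>. g (Min B) (Max B))"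

definition pairing_sum ::
  "real \<Rightarrow> real \<Rightarrow> (nat \<Rightarrow> nat \<Rightarrow> complex) \<Rightarrow> nat set \<Rightarrow> nat set \<Rightarrow> complex" where
  "pairing_sum q t g A Op = (\<Sum>\<rho>\<in>pairings A Op. weight q t g \<rho>)"

lemma pair_block:
  fixes B :: "'a::linorder set"
  assumes "card B = 2"
  shows "B = {Min B, Max B}" "Min B < Max B" "Min B \<in> B" "Max B \<in> B"
proof -
  obtain x y where xy: "B = {x, y}" "x \<noteq> y"
    using assms by (auto simp: card_2_iff)
  then show "B = {Min B, Max B}" "Min B < Max B" "Min B \<in> B" "Max B \<in> B"
    by (auto simp: min_def max_def)
qed

lemma partition_block_unique:
  "partition_on A \<rho> \<Longrightarrow> B \<in> \<rho> \<Longrightarrow> C \<in> \<rho> \<Longrightarrow> x \<in> B \<Longrightarrow> x \<in> C \<Longrightarrow> B = C"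
  unfolding partition_on_def disjoint_def by blast

lemma finite_pairings: "finite A \<Longrightarrow> finite (pairings A Op)"
  unfolding pairings_def by (rule finite_subset[OF _ finitely_many_partition_on]) auto

lemma finite_pairing: "\<rho> \<in> pairings A Op \<Longrightarrow> finite A \<Longrightarrow> finite \<rho>"
  unfolding pairings_def by (auto intro: finite_elements)

lemma pairings_block:
  assumes "\<rho> \<in> pairings A Op" "B \<in> \<rho>"
  shows "B = {Min B, Max B}" "Min B < Max B" "Min B \<in> A" "Max B \<in> A" "Min B \<in> Op" "B \<subseteq> A"
proof -
  have "card B = 2" and BA: "B \<subseteq> A" and "Min B \<in> Op"
    using assms by (auto simp: pairings_def partition_on_def)
  from pair_block[OF this(1)] BA this(3)
  show "B = {Min B, Max B}" "Min B < Max B" "Min B \<in> A" "Max B \<in> A" "Min B \<in> Op" "B \<subseteq> A"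
    by auto
qed

lemma pairings_inj_Max: "\<rho> \<in> pairings A Op \<Longrightarrow> inj_on Max \<rho>"
  by (rule inj_onI) (metis (mono_tags, lifting) mem_Collect_eq pair_block(4) pairings_def partition_block_unique)

text \<open>A point outside \<open>Op\<close> is the maximum of exactly one block, so counting blocks by their closers
  is the same as counting points.\<close>

lemma card_blocks_by_closer:
  assumes \<rho>: "\<rho> \<in> pairings A Op" and late: "\<And>s. P s \<Longrightarrow> s \<notin> Op"
  shows "card {B \<in> \<rho>. P (Max B)} = card {s \<in> A. P s}"
proof -
  have "Max ` {B \<in> \<rho>. P (Max B)} = {s \<in> A. P s}"
  proof (intro equalityI subsetI)
    fix s assume "s \<in> {s \<in> A. P s}"
    then have s: "s \<in> A" "P s" by auto
    then obtain B where B: "B \<in> \<rho>" "s \<in> B"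
      using \<rho> by (auto simp: pairings_def partition_on_def)
    have "s \<noteq> Min B" using pairings_block(5)[OF \<rho> B(1)] late[OF s(2)] by auto
    then have "s = Max B" using pairings_block(1)[OF \<rho> B(1)] B(2) by auto
    then show "s \<in> Max ` {B \<in> \<rho>. P (Max B)}" using B s by auto
  qed (use pairings_block(4)[OF \<rho>] in auto)
  moreover have "inj_on Max {B \<in> \<rho>. P (Max B)}"
    using pairings_inj_Max[OF \<rho>] by (rule inj_on_subset) auto
  ultimately show ?thesis by (metis card_image)
qed

text \<open>
  The effect of adding a block \<open>{a, c}\<close> whose opener \<open>a\<close> lies to the right of all openers of \<open>\<rho>\<close>.
  Since every block of \<open>\<rho>\<close> opens before \<open>a\<close>, it interacts with \<open>{a, c}\<close> according to the position of
  its closer alone: between \<open>a\<close> and \<open>c\<close> it gives a crossing, beyond \<open>c\<close> a nesting.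
\<close>

context
  fixes \<rho> :: "nat set set" and A Op :: "nat set" and a c :: nat
  assumes \<rho>: "\<rho> \<in> pairings A Op" and fin: "finite A"
    and first: "Op \<subseteq> {..<a}" and new: "a \<notin> A" "c \<notin> A" "a < c"
begin

lemma new_block: "Min {a, c} = a" "Max {a, c} = c" "{a, c} \<notin> \<rho>"
  using new pairings_block(6)[OF \<rho>, of "{a, c}"] by auto

lemma crossings_insert:
  "crossings (insert {a, c} \<rho>) = crossings \<rho> + card {s \<in> A. a < s \<and> s < c}"
proof -
  let ?X = "{(B, C). B \<in> \<rho> \<and> C \<in> \<rho> \<and> Min B < Min C \<and> Min C < Max B \<and> Max B < Max C}"
  let ?Y = "{B \<in> \<rho>. a < Max B \<and> Max B < c}"
  have early: "Min B < a" if "B \<in> \<rho>" for B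
    using pairings_block(5)[OF \<rho> that] first by auto
  have "{(B, C). B \<in> insert {a, c} \<rho> \<and> C \<in> insert {a, c} \<rho> \<and> Min B < Min C \<and> Min C < Max B \<and> Max B < Max C}
      = ?X \<union> (\<lambda>B. (B, {a, c})) ` ?Y"
    using early new_block by (auto dest: early)
  moreover have "finite ?X"
    by (rule finite_subset[of _ "\<rho> \<times> \<rho>"]) (use finite_pairing[OF \<rho> fin] in auto)
  moreover have "finite ?Y" using finite_pairing[OF \<rho> fin] by auto
  moreover have "?X \<inter> (\<lambda>B. (B, {a, c})) ` ?Y = {}" using new_block(3) by auto
  moreover have "card ((\<lambda>B. (B, {a, c})) ` ?Y) = card ?Y" by (rule card_image) (auto intro: inj_onI)
  moreover have "card ?Y = card {s \<in> A. a < s \<and> s < c}"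
    by (rule card_blocks_by_closer[OF \<rho>]) (use first in auto)
  ultimately show ?thesis by (simp add: crossings_def card_Un_disjoint)
qed

lemma nestings_insert:
  "nestings (insert {a, c} \<rho>) = nestings \<rho> + card {s \<in> A. c < s}"
proof -
  let ?X = "{(B, C). B \<in> \<rho> \<and> C \<in> \<rho> \<and> Min B < Min C \<and> Min C < Max C \<and> Max C < Max B}"
  let ?Y = "{B \<in> \<rho>. c < Max B}"
  have early: "Min B < a" if "B \<in> \<rho>" for B
    using pairings_block(5)[OF \<rho> that] first by auto
  have "{(B, C). B \<in> insert {a, c} \<rho> \<and> C \<in> insert {a, c} \<rho> \<and> Min B < Min C \<and> Min C < Max C \<and> Max C < Max B}
      = ?X \<union> (\<lambda>B. (B, {a, c})) ` ?Y"
    using early new_block new by (auto dest: early)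
  moreover have "finite ?X"
    by (rule finite_subset[of _ "\<rho> \<times> \<rho>"]) (use finite_pairing[OF \<rho> fin] in auto)
  moreover have "finite ?Y" using finite_pairing[OF \<rho> fin] by auto
  moreover have "?X \<inter> (\<lambda>B. (B, {a, c})) ` ?Y = {}" using new_block(3) by auto
  moreover have "card ((\<lambda>B. (B, {a, c})) ` ?Y) = card ?Y" by (rule card_image) (auto intro: inj_onI)
  moreover have "card ?Y = card {s \<in> A. c < s}"
    by (rule card_blocks_by_closer[OF \<rho>]) (use first new in auto)
  ultimately show ?thesis by (simp add: nestings_def card_Un_disjoint)
qed

lemma weight_insert:
  "weight q t g (insert {a, c} \<rho>) =
   complex_of_real (q ^ card {s \<in> A. a < s \<and> s < c} * t ^ card {s \<in> A. c < s}) * g a c * weight q t g \<rho>"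
  using new_block finite_pairing[OF \<rho> fin]
  by (simp add: weight_def crossings_insert nestings_insert power_add mult_ac)

end

lemma pairings_insert_block:
  assumes A: "finite A" "a \<in> A" "c \<in> A" "a < c" and Op: "a \<in> Op"
    and \<rho>: "\<rho> \<in> pairings (A - {a, c}) (Op - {a})"
  shows "insert {a, c} \<rho> \<in> pairings A Op"
proof -
  have p: "partition_on (A - {a, c}) \<rho>" and r: "\<forall>B\<in>\<rho>. card B = 2" "Min ` \<rho> = Op - {a}"
    using \<rho> by (auto simp: pairings_def)
  have "disjnt {a, c} (\<Union>\<rho>)" using p by (auto simp: partition_on_def disjnt_def)
  then have "partition_on A (insert {a, c} \<rho>)" using p A by (simp add: partition_on_insert)
  moreover have "Min {a, c} = a" "card {a, c} = 2" using A by auto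
  ultimately show ?thesis using r Op by (auto simp: pairings_def)
qed

lemma pairings_remove_block:
  assumes \<rho>: "\<rho> \<in> pairings A Op" and B: "B \<in> \<rho>"
  shows "\<rho> - {B} \<in> pairings (A - B) (Op - {Min B})"
proof -
  have p: "partition_on A \<rho>" and r: "\<forall>C\<in>\<rho>. card C = 2" "Min ` \<rho> = Op"
    using \<rho> by (auto simp: pairings_def)
  have "C \<inter> B = {}" if "C \<in> \<rho> - {B}" for C
    using partition_block_unique[OF p _ B] that by blast
  then have "disjnt B (\<Union>(\<rho> - {B}))" by (auto simp: disjnt_def)
  then have "partition_on (A - B) (\<rho> - {B})"
    using p B partition_on_insert[of B "\<rho> - {B}" A] by (simp add: insert_absorb)
  moreover have "Min C \<noteq> Min B" if "C \<in> \<rho> - {B}" for C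
    using partition_block_unique[OF p, of C B "Min B"] that B pair_block(3) r(1)
    by (metis DiffD1 DiffD2 singletonI)
  then have "Min ` (\<rho> - {B}) = Op - {Min B}" using r(2) by auto
  ultimately show ?thesis using r by (auto simp: pairings_def)
qed

text \<open>Every pair partition arises exactly once by choosing the partner \<open>c\<close> of the largest opener \<open>a\<close>
  and a pair partition of the other points.\<close>

lemma pairing_sum_last_opener:
  assumes A: "finite A" "a \<in> A" and Op: "a \<in> Op" "Op \<subseteq> {..a}"
  shows "pairing_sum q t g A Op =
    (\<Sum>c | c \<in> A \<and> a < c.
      complex_of_real (q ^ card {s \<in> A. a < s \<and> s < c} * t ^ card {s \<in> A. c < s}) * g a c *
      pairing_sum q t g (A - {a, c}) (Op - {a}))"
proof -
  let ?C = "{c \<in> A. a < c}" and ?P = "\<lambda>c. pairings (A - {a, c}) (Op - {a})"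
  let ?w = "\<lambda>c. complex_of_real (q ^ card {s \<in> A. a < s \<and> s < c} * t ^ card {s \<in> A. c < s}) * g a c"
  have w: "weight q t g (insert {a, c} \<rho>) = ?w c * weight q t g \<rho>" if "c \<in> ?C" "\<rho> \<in> ?P c" for c \<rho>
  proof -
    have "{s \<in> A - {a, c}. a < s \<and> s < c} = {s \<in> A. a < s \<and> s < c}"
      "{s \<in> A - {a, c}. c < s} = {s \<in> A. c < s}" using that by auto
    then show ?thesis
      using weight_insert[OF that(2), of a c q t g] that A Op by fastforce
  qed
  have notin: "a \<notin> B" if "c \<in> ?C" "\<rho> \<in> ?P c" "B \<in> \<rho>" for c \<rho> B
    using pairings_block(6)[OF that(2,3)] by auto
  have inj: "inj_on (\<lambda>(c, \<rho>). insert {a, c} \<rho>) (SIGMA c:?C. ?P c)"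
  proof (rule inj_onI, clarify)
    fix c \<rho> c' \<rho>'
    assume c: "c \<in> A" "a < c" "c' \<in> A" "a < c'" and \<rho>: "\<rho> \<in> ?P c" "\<rho>' \<in> ?P c'"
      and eq: "insert {a, c} \<rho> = insert {a, c'} \<rho>'"
    have "{a, c} \<notin> \<rho>'" "{a, c} \<notin> \<rho>" "{a, c'} \<notin> \<rho>'"
      using notin[of c \<rho> "{a, c}"] notin[of c' \<rho>' "{a, c}"] notin[of c' \<rho>' "{a, c'}"] c \<rho> by auto
    with eq have "{a, c} = {a, c'}" by blast
    then show "c = c' \<and> \<rho> = \<rho>'"
      using eq c \<open>{a, c} \<notin> \<rho>'\<close> \<open>{a, c} \<notin> \<rho>\<close> by (metis doubleton_eq_iff insert_ident)
  qed
  have img: "(\<lambda>(c, \<rho>). insert {a, c} \<rho>) ` (SIGMA c:?C. ?P c) = pairings A Op"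
  proof (intro equalityI subsetI)
    fix \<rho> assume \<rho>: "\<rho> \<in> pairings A Op"
    then obtain B where B: "B \<in> \<rho>" "Min B = a" using Op by (auto simp: pairings_def)
    have Ba: "B = {a, Max B}" using pairings_block(1)[OF \<rho> B(1)] B(2) by simp
    have "Max B \<in> ?C" using pairings_block(2,4)[OF \<rho> B(1)] B(2) by simp
    moreover have "\<rho> - {B} \<in> ?P (Max B)"
      using pairings_remove_block[OF \<rho> B(1)] B(2) Ba by metis
    moreover have "\<rho> = insert {a, Max B} (\<rho> - {B})" using B(1) Ba by auto
    ultimately show "\<rho> \<in> (\<lambda>(c, \<rho>). insert {a, c} \<rho>) ` (SIGMA c:?C. ?P c)"
      by (metis (no_types, lifting) SigmaI case_prod_conv image_eqI)
  qed (use A Op in \<open>auto intro: pairings_insert_block\<close>)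
  have "pairing_sum q t g A Op = (\<Sum>(c, \<rho>)\<in>(SIGMA c:?C. ?P c). weight q t g (insert {a, c} \<rho>))"
    unfolding pairing_sum_def img[symmetric]
    by (subst sum.reindex[OF inj]) (simp add: case_prod_unfold)
  also have "\<dots> = (\<Sum>c\<in>?C. \<Sum>\<rho>\<in>?P c. weight q t g (insert {a, c} \<rho>))"
    using A by (intro sum.Sigma[symmetric]) (auto intro: finite_pairings)
  also have "\<dots> = (\<Sum>c\<in>?C. ?w c * pairing_sum q t g (A - {a, c}) (Op - {a}))"
    unfolding pairing_sum_def sum_distrib_left by (intro sum.cong refl w)
  finally show ?thesis by simp
qed

lemma pairing_sum_no_opener: "pairing_sum q t g A {} = (if A = {} then 1 else 0)"
proof -
  have "pairings A {} = (if A = {} then {{}} else {})"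
    by (auto simp: pairings_def partition_on_def)
  moreover have "weight q t g {} = 1" by (simp add: weight_def crossings_def nestings_def)
  ultimately show ?thesis by (simp add: pairing_sum_def)
qed

lemma strict_sorted_nth_less:
  "sorted_wrt (<) ls \<Longrightarrow> i < length ls \<Longrightarrow> j < length ls \<Longrightarrow> ls ! i < ls ! j \<longleftrightarrow> i < (j::nat)"
  for ls :: "nat list"
  by (metis linorder_neqE_nat not_less_iff_gr_or_eq sorted_wrt_nth_less)

text \<open>The same recursion in the form produced by the annihilation operator: the points beyond \<open>Suc k\<close>
  are listed in increasing order, so the numbers of points to the left and to the right of the chosen
  partner are determined by its position in the list.\<close>

lemma pairing_sum_last_opener_list:
  assumes ls: "sorted_wrt (<) ls" "\<And>s. s \<in> set ls \<Longrightarrow> Suc k < s" and Op: "Op \<subseteq> {1..k}"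
  shows "pairing_sum q t g ({1..Suc k} \<union> set ls) (insert (Suc k) Op) =
    (\<Sum>i<length ls. complex_of_real (q ^ i * t ^ (length ls - 1 - i)) * g (Suc k) (ls ! i) *
      pairing_sum q t g ({1..k} \<union> set (take i ls @ drop (Suc i) ls)) Op)"
proof -
  let ?A = "{1..Suc k} \<union> set ls"
  let ?f = "\<lambda>c. complex_of_real (q ^ card {s \<in> ?A. Suc k < s \<and> s < c} * t ^ card {s \<in> ?A. c < s}) *
      g (Suc k) c * pairing_sum q t g (?A - {Suc k, c}) (insert (Suc k) Op - {Suc k})"
  have dist: "distinct ls" using ls(1) strict_sorted_iff by blast
  have "pairing_sum q t g ?A (insert (Suc k) Op) = (\<Sum>c | c \<in> ?A \<and> Suc k < c. ?f c)"
    by (rule pairing_sum_last_opener) (use Op in auto)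
  also have "{c. c \<in> ?A \<and> Suc k < c} = set ls" using ls(2) by auto
  also have "(\<Sum>c\<in>set ls. ?f c) = (\<Sum>i<length ls. ?f (ls ! i))"
    using bij_betw_nth[OF dist refl refl] by (rule sum.reindex_bij_betw[symmetric])
  also have "\<dots> = (\<Sum>i<length ls. complex_of_real (q ^ i * t ^ (length ls - 1 - i)) * g (Suc k) (ls ! i) *
      pairing_sum q t g ({1..k} \<union> set (take i ls @ drop (Suc i) ls)) Op)"
  proof (rule sum.cong[OF refl])
    fix i assume "i \<in> {..<length ls}"
    then have i: "i < length ls" by simp
    have inj: "inj_on ((!) ls) I" if "I \<subseteq> {..<length ls}" for I
      using that by (intro inj_onI) (meson dist lessThan_iff nth_eq_iff_index_eq subsetD)
    have big: "Suc k < ls ! j" if "j < length ls" for j using ls(2) that by auto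
    have pos: "{s \<in> set ls. R s} = (!) ls ` {j. j < length ls \<and> R (ls ! j)}" for R
      by (auto simp: in_set_conv_nth)
    have "{s \<in> ?A. Suc k < s \<and> s < ls ! i} = {s \<in> set ls. s < ls ! i}" using ls(2) by auto
    also have "\<dots> = (!) ls ` {..<i}"
      unfolding pos using i by (intro arg_cong[where f = "image _"]) (auto simp: strict_sorted_nth_less[OF ls(1)])
    finally have 1: "card {s \<in> ?A. Suc k < s \<and> s < ls ! i} = i"
      using i by (simp add: card_image inj)
    have "{s \<in> ?A. ls ! i < s} = {s \<in> set ls. ls ! i < s}" using big[OF i] by auto
    also have "\<dots> = (!) ls ` {i<..<length ls}"
      unfolding pos using i by (intro arg_cong[where f = "image _"]) (auto simp: strict_sorted_nth_less[OF ls(1)])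
    finally have 2: "card {s \<in> ?A. ls ! i < s} = length ls - 1 - i"
      by (simp add: card_image inj subset_iff)
    have "ls = take i ls @ ls ! i # drop (Suc i) ls" using i by (rule id_take_nth_drop)
    then have "set (take i ls @ drop (Suc i) ls) = set ls - {ls ! i}"
      using dist by (metis distinct_append distinct.simps(2) remove1_append remove1.simps(2) set_remove1_eq not_distinct_conv_prefix)
    then have 3: "?A - {Suc k, ls ! i} = {1..k} \<union> set (take i ls @ drop (Suc i) ls)"
      using big[OF i] ls(2) by (auto simp: le_Suc_eq)
    have 4: "insert (Suc k) Op - {Suc k} = Op" using Op by auto
    show "?f (ls ! i) = complex_of_real (q ^ i * t ^ (length ls - 1 - i)) * g (Suc k) (ls ! i) *
      pairing_sum q t g ({1..k} \<union> set (take i ls @ drop (Suc i) ls)) Op"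
      by (simp only: 1 2 3 4)
  qed
  finally show ?thesis .
qed


section \<open>The vacuum expectation as a linear functional\<close>

lemma P_op_add: "P_op q t v w (f + g) = P_op q t v w f + P_op q t v w g"
  by transfer
    (auto intro!: fdig_relI op_tensor_diagonal diagonal_add diagonal_sum diagonal_scale
      simp: fdig_rel_def sym_op_def ftensor_sum_left ftensor_sum_right ftensor_scale_left ftensor_scale_right,
      simp add: op_tensor_def lin_ext_add)

lemma P_op_scale: "P_op q t v w (scale_fdig c f) = scale_fdig c (P_op q t v w f)"
  by transfer
    (auto intro!: fdig_relI op_tensor_diagonal diagonal_sum diagonal_scale
      simp: fdig_rel_def sym_op_def ftensor_sum_left ftensor_sum_right ftensor_scale_left ftensor_scale_right,
      simp add: op_tensor_def lin_ext_scale)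

lemma fock_inner_add: "fock_inner q t v w h (f + g) = fock_inner q t v w h f + fock_inner q t v w h g"
  unfolding fock_inner_def P_op_add by transfer (rule sesq_ext_add_right)

lemma fock_inner_scale: "fock_inner q t v w h (scale_fdig c f) = c * fock_inner q t v w h f"
  unfolding fock_inner_def P_op_scale by transfer (rule sesq_ext_scale_right)

lemma sym_op_Nil: "sym_op q t [] = word []"
  by (simp add: sym_op_def inversions_def binomial_eq_0)

lemma sesq_ext_sum_right: "sesq_ext K f (sum g A) = (\<Sum>x\<in>A. sesq_ext K f (g x))"
  by (induction A rule: infinite_finite_induct) (simp_all add: sesq_ext_add_right)

text \<open>The symmetrisation preserves the degree, so only a tensor of degree zero can meet the vacuum.\<close>

lemma fock_inner_vacuum_pure:
  assumes "length us = length vs"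
  shows "fock_inner q t v w vacuum (pure_tensor us vs) = (if us = [] then 1 else 0)"
  unfolding fock_inner_def using assms
proof (transfer fixing: q t v w)
  fix us :: "'a complexification list" and vs :: "'b complexification list"
  assume len: "length us = length vs"
  show "sesq_ext pair_inner (word ([], [])) (op_tensor (sym_op q t) (sym_op v w)
      (if length us = length vs then word (us, vs) else 0)) = (if us = [] then 1 else 0)"
  proof (cases "us = []")
    case True
    then show ?thesis using len
      by (simp add: op_tensor_def sym_op_Nil pair_inner_def word_inner_def)
  next
    case False
    have "word_inner [] (permute_list \<sigma> us) = 0" for \<sigma>
      using False by (simp add: word_inner_def)
    then show ?thesis using len False
      by (simp add: op_tensor_def sym_op_def[of q t us] sym_op_def[of v w vs] ftensor_sum_left ftensor_sum_right
          ftensor_scale_left ftensor_scale_right sesq_ext_sum_right sesq_ext_scale_right pair_inner_def)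
  qed
qed

lemma G_op_add: "G_op q t v w x y (f + g) = G_op q t v w x y f + G_op q t v w x y g"
  by (simp add: G_op_def A_op_add A_star_add)

lemma scale_fdig_add: "scale_fdig c (f + g) = scale_fdig c f + scale_fdig c g"
  by transfer (auto intro!: fdig_relI diagonal_add diagonal_scale simp: fdig_rel_def fscale_add)

lemma G_op_scale: "G_op q t v w x y (scale_fdig c f) = scale_fdig c (G_op q t v w x y f)"
  by (simp add: G_op_def A_op_scale A_star_scale scale_fdig_add)

lemma G_prod_0: "G_prod q t v w \<xi> \<eta> 0 = id"
  by (simp add: G_prod_def)

lemma foldr_comp_id: "foldr (\<circ>) fs g = foldr (\<circ>) fs id \<circ> g"
  by (induction fs) (simp_all add: comp_assoc)

lemma G_prod_Suc:
  "G_prod q t v w \<xi> \<eta> (Suc k) f = G_prod q t v w \<xi> \<eta> k (G_op q t v w (\<xi> (Suc k)) (\<eta> (Suc k)) f)"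
  using foldr_comp_id[of "map (\<lambda>i. G_op q t v w (\<xi> i) (\<eta> i)) [1..<k + 1]"
      "G_op q t v w (\<xi> (Suc k)) (\<eta> (Suc k))"]
  by (simp add: G_prod_def fun_eq_iff)

definition vacuum_coeff where
  "vacuum_coeff q t v w \<xi> \<eta> k f = fock_inner q t v w vacuum (G_prod q t v w \<xi> \<eta> k f)"

lemma vacuum_coeff_add:
  "vacuum_coeff q t v w \<xi> \<eta> k (f + g) = vacuum_coeff q t v w \<xi> \<eta> k f + vacuum_coeff q t v w \<xi> \<eta> k g"
proof -
  have "G_prod q t v w \<xi> \<eta> k (f + g) = G_prod q t v w \<xi> \<eta> k f + G_prod q t v w \<xi> \<eta> k g"
    by (induction k arbitrary: f g) (simp_all add: G_prod_0 G_prod_Suc G_op_add)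
  then show ?thesis by (simp add: vacuum_coeff_def fock_inner_add)
qed

lemma vacuum_coeff_scale:
  "vacuum_coeff q t v w \<xi> \<eta> k (scale_fdig c f) = c * vacuum_coeff q t v w \<xi> \<eta> k f"
proof -
  have "G_prod q t v w \<xi> \<eta> k (scale_fdig c f) = scale_fdig c (G_prod q t v w \<xi> \<eta> k f)"
    by (induction k arbitrary: f) (simp_all add: G_prod_0 G_prod_Suc G_op_scale)
  then show ?thesis by (simp add: vacuum_coeff_def fock_inner_scale)
qed

lemma vacuum_coeff_sum:
  "vacuum_coeff q t v w \<xi> \<eta> k (sum f I) = (\<Sum>i\<in>I. vacuum_coeff q t v w \<xi> \<eta> k (f i))"
proof -
  have "vacuum_coeff q t v w \<xi> \<eta> k 0 = 0"
    using vacuum_coeff_add[of q t v w \<xi> \<eta> k 0 0] by simp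
  then show ?thesis
    by (induction I rule: infinite_finite_induct) (simp_all add: vacuum_coeff_add)
qed

abbreviation gram :: "(nat \<Rightarrow> 'a::real_inner) \<Rightarrow> nat \<Rightarrow> nat \<Rightarrow> complex" where
  "gram \<xi> i j \<equiv> cinner (cplx (\<xi> i)) (cplx (\<xi> j))"

abbreviation tensor_at :: "(nat \<Rightarrow> 'a::real_inner) \<Rightarrow> nat list \<Rightarrow> 'a complexification list" where
  "tensor_at \<xi> \<equiv> map (\<lambda>i. cplx (\<xi> i))"

lemma sum_Pow_insert:
  assumes "finite A" "a \<notin> A"
  shows "(\<Sum>X\<in>Pow (insert a A). f X) = (\<Sum>X\<in>Pow A. f (insert a X)) + (\<Sum>X\<in>Pow A. f X)"
proof -
  have "inj_on (insert a) (Pow A)" "Pow A \<inter> insert a ` Pow A = {}"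
    using assms by (auto simp: inj_on_def)
  then show ?thesis
    using assms by (simp add: Pow_insert sum.union_disjoint sum.reindex add.commute)
qed

text \<open>The labels \<open>ls\<close> and \<open>ms\<close> are the closers in the two legs that are still without a partner;
  they differ in general, because one annihilation may remove different positions in the two legs.
  In the step from \<open>k\<close> to \<open>Suc k\<close>, the creation part makes \<open>Suc k\<close> the smallest waiting closer, which
  keeps the lists sorted and covers the opener sets without \<open>Suc k\<close>; the annihilation part covers
  those containing it.\<close>

lemma vacuum_coeff_pure:
  fixes \<xi> :: "nat \<Rightarrow> 'a::real_inner" and \<eta> :: "nat \<Rightarrow> 'b::real_inner"
  assumes "sorted_wrt (<) ls" "sorted_wrt (<) ms" "length ls = length ms"
    and "\<And>s. s \<in> set ls \<union> set ms \<Longrightarrow> k < s"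
  shows "vacuum_coeff q t v w \<xi> \<eta> k (pure_tensor (tensor_at \<xi> ls) (tensor_at \<eta> ms)) =
    (\<Sum>Op\<in>Pow {1..k}. pairing_sum q t (gram \<xi>) ({1..k} \<union> set ls) Op *
                      pairing_sum v w (gram \<eta>) ({1..k} \<union> set ms) Op)"
  using assms
proof (induction k arbitrary: ls ms)
  case 0
  then show ?case
    by (auto simp: vacuum_coeff_def G_prod_0 fock_inner_vacuum_pure pairing_sum_no_opener)
next
  case (Suc k)
  let ?L = "vacuum_coeff q t v w \<xi> \<eta> k"
  let ?F = "pairing_sum q t (gram \<xi>)" and ?G = "pairing_sum v w (gram \<eta>)"
  let ?pure = "pure_tensor (tensor_at \<xi> ls) (tensor_at \<eta> ms)"
  let ?d = "\<lambda>i ls. take i ls @ drop (Suc i) ls"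
  define C where "C i = complex_of_real (q ^ i * t ^ (length ls - 1 - i)) * gram \<xi> (Suc k) (ls ! i)" for i
  define D where "D j = complex_of_real (v ^ j * w ^ (length ms - 1 - j)) * gram \<eta> (Suc k) (ms ! j)" for j
  have gt: "Suc k < s" if "s \<in> set ls \<or> s \<in> set ms" for s using Suc.prems(4) that by auto
  have sorted_d: "sorted_wrt (<) (?d i ns)" if "sorted_wrt (<) ns" for i and ns :: "nat list"
  proof (cases "i < length ns")
    case True
    then have "sorted_wrt (<) (take i ns @ ns ! i # drop (Suc i) ns)"
      using that id_take_nth_drop[OF True] by simp
    then show ?thesis by (auto simp: sorted_wrt_append)
  qed (use that in simp)
  have sub_d: "set (?d i ns) \<subseteq> set ns" for i and ns :: "nat list"
    by (auto dest: in_set_takeD in_set_dropD)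
  have cover: "{1..Suc k} \<union> X = {1..k} \<union> insert (Suc k) X" for X by (auto simp: le_Suc_eq)

  have create: "?L (A_star (\<xi> (Suc k)) (\<eta> (Suc k)) ?pure) =
      (\<Sum>Op\<in>Pow {1..k}. ?F ({1..Suc k} \<union> set ls) Op * ?G ({1..Suc k} \<union> set ms) Op)"
  proof -
    have "A_star (\<xi> (Suc k)) (\<eta> (Suc k)) ?pure =
        pure_tensor (tensor_at \<xi> (Suc k # ls)) (tensor_at \<eta> (Suc k # ms))"
      using Suc.prems(3) by (simp add: A_star_pure)
    also have "?L \<dots> = (\<Sum>Op\<in>Pow {1..k}. ?F ({1..k} \<union> set (Suc k # ls)) Op *
                                            ?G ({1..k} \<union> set (Suc k # ms)) Op)"
      using Suc.prems gt by (intro Suc.IH) (auto intro: less_trans[OF lessI])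
    finally show ?thesis by (simp only: cover list.set)
  qed

  have summand: "?L (pure_tensor (tensor_at \<xi> (?d i ls)) (tensor_at \<eta> (?d j ms))) =
      (\<Sum>Op\<in>Pow {1..k}. ?F ({1..k} \<union> set (?d i ls)) Op * ?G ({1..k} \<union> set (?d j ms)) Op)"
    if "i < length ls" "j < length ms" for i j
  proof (rule Suc.IH)
    show "length (?d i ls) = length (?d j ms)" using that Suc.prems(3) by simp
    show "k < s" if "s \<in> set (?d i ls) \<union> set (?d j ms)" for s
    proof -
      have "s \<in> set ls \<or> s \<in> set ms" using that sub_d[of i ls] sub_d[of j ms] by blast
      then show ?thesis using gt by (simp add: Suc_lessD)
    qed
  qed (use sorted_d Suc.prems in auto)
  have "A_op q t v w (\<xi> (Suc k)) (\<eta> (Suc k)) ?pure = (\<Sum>i<length ls. \<Sum>j<length ms.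
      scale_fdig (C i * D j) (pure_tensor (tensor_at \<xi> (?d i ls)) (tensor_at \<eta> (?d j ms))))"
    using Suc.prems(3) by (subst A_op_pure) (simp_all add: C_def D_def take_map drop_map)
  then have "?L (A_op q t v w (\<xi> (Suc k)) (\<eta> (Suc k)) ?pure) = (\<Sum>i<length ls. \<Sum>j<length ms. C i * D j *
      (\<Sum>Op\<in>Pow {1..k}. ?F ({1..k} \<union> set (?d i ls)) Op * ?G ({1..k} \<union> set (?d j ms)) Op))"
    by (simp add: vacuum_coeff_sum vacuum_coeff_scale summand del: map_append set_append)
  \<comment> \<open>For a fixed opener set the two legs are independent, so the double sum over positions factors.\<close>
  also have "\<dots> = (\<Sum>i<length ls. \<Sum>Op\<in>Pow {1..k}. \<Sum>j<length ms.
      (C i * ?F ({1..k} \<union> set (?d i ls)) Op) * (D j * ?G ({1..k} \<union> set (?d j ms)) Op))"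
    unfolding sum_distrib_left by (subst (2) sum.swap) (simp only: mult_ac)
  also have "\<dots> = (\<Sum>Op\<in>Pow {1..k}. (\<Sum>i<length ls. C i * ?F ({1..k} \<union> set (?d i ls)) Op) *
                                    (\<Sum>j<length ms. D j * ?G ({1..k} \<union> set (?d j ms)) Op))"
    unfolding sum_product by (rule sum.swap)
  also have "\<dots> = (\<Sum>Op\<in>Pow {1..k}. ?F ({1..Suc k} \<union> set ls) (insert (Suc k) Op) *
                                    ?G ({1..Suc k} \<union> set ms) (insert (Suc k) Op))"
  proof (intro sum.cong refl)
    fix Op assume "Op \<in> Pow {1..k}"
    then have Op: "Op \<subseteq> {1..k}" by simp
    have "(\<Sum>i<length ls. C i * ?F ({1..k} \<union> set (?d i ls)) Op) = ?F ({1..Suc k} \<union> set ls) (insert (Suc k) Op)"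
      unfolding C_def using Suc.prems(1) gt Op by (intro pairing_sum_last_opener_list[symmetric]) auto
    moreover have "(\<Sum>j<length ms. D j * ?G ({1..k} \<union> set (?d j ms)) Op) = ?G ({1..Suc k} \<union> set ms) (insert (Suc k) Op)"
      unfolding D_def using Suc.prems(2) gt Op by (intro pairing_sum_last_opener_list[symmetric]) auto
    ultimately show "(\<Sum>i<length ls. C i * ?F ({1..k} \<union> set (?d i ls)) Op) *
        (\<Sum>j<length ms. D j * ?G ({1..k} \<union> set (?d j ms)) Op) =
        ?F ({1..Suc k} \<union> set ls) (insert (Suc k) Op) * ?G ({1..Suc k} \<union> set ms) (insert (Suc k) Op)"
      by (simp only:)
  qed
  finally have annihilate: "?L (A_op q t v w (\<xi> (Suc k)) (\<eta> (Suc k)) ?pure) = \<dots>" .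

  have "{1..Suc k} = insert (Suc k) {1..k}" by auto
  then have "Pow {1..Suc k} = Pow (insert (Suc k) {1..k})" by (rule arg_cong)
  moreover have "vacuum_coeff q t v w \<xi> \<eta> (Suc k) ?pure =
      ?L (A_op q t v w (\<xi> (Suc k)) (\<eta> (Suc k)) ?pure) + ?L (A_star (\<xi> (Suc k)) (\<eta> (Suc k)) ?pure)"
    by (simp add: vacuum_coeff_def[of _ _ _ _ _ _ "Suc k"] G_prod_Suc flip: vacuum_coeff_def)
      (simp add: G_op_def vacuum_coeff_add)
  ultimately show ?case
    by (simp only:) (subst sum_Pow_insert, simp, simp, simp only: create annihilate)
qed


section \<open>Diagonal pair partitions as pairs of pair partitions\<close>

lemma left_right_image:
  assumes "\<And>B. B \<in> \<pi> \<Longrightarrow> B \<subseteq> range Inl \<or> B \<subseteq> range Inr"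
  shows "\<pi> = image Inl ` left_part \<pi> \<union> image Inr ` right_part \<pi>"
proof (intro equalityI subsetI)
  fix B assume B: "B \<in> \<pi>"
  then consider "B = Inl ` (Inl -` B)" | "B = Inr ` (Inr -` B)" using assms[OF B] by blast
  then show "B \<in> image Inl ` left_part \<pi> \<union> image Inr ` right_part \<pi>"
    by cases (metis (mono_tags, lifting) B UnI1 UnI2 image_eqI left_part_def mem_Collect_eq right_part_def)+
qed (auto simp: left_part_def right_part_def)

lemma image_Inl_Inr_eq:
  "Inl ` B = Inl ` C \<longleftrightarrow> B = C" "Inr ` B = Inr ` C \<longleftrightarrow> B = C"
  "Inl ` B = Inr ` C \<longleftrightarrow> B = {} \<and> C = {}" "Inr ` B = Inl ` C \<longleftrightarrow> B = {} \<and> C = {}"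
  by (auto simp: inj_image_eq_iff)

text \<open>Nonemptiness matters because the empty block has the same image in both copies.\<close>

lemma left_right_part_union:
  assumes "{} \<notin> \<rho>" "{} \<notin> \<sigma>"
  shows "left_part (image Inl ` \<rho> \<union> image Inr ` \<sigma>) = \<rho>"
    and "right_part (image Inl ` \<rho> \<union> image Inr ` \<sigma>) = \<sigma>"
  using assms by (auto simp: left_part_def right_part_def image_Inl_Inr_eq)

lemma diag_pair_partition_parts:
  assumes \<pi>: "\<pi> \<in> diag_pair_partitions n"
  shows "left_part \<pi> \<in> pairings {1..n} (Min ` left_part \<pi>)"
    and "right_part \<pi> \<in> pairings {1..n} (Min ` left_part \<pi>)"
proof -
  have p: "partition_on (Inl ` {1..n} \<union> Inr ` {1..n}) \<pi>"
    and b: "\<And>B. B \<in> \<pi> \<Longrightarrow> card B = 2" "\<And>B. B \<in> \<pi> \<Longrightarrow> B \<subseteq> range Inl \<or> B \<subseteq> range Inr"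
    and m: "Min ` left_part \<pi> = Min ` right_part \<pi>"
    using \<pi> by (auto simp: diag_pair_partitions_def)
  have U: "\<Union>\<pi> = Inl ` {1..n} \<union> Inr ` {1..n}" and D: "\<And>B C. B \<in> \<pi> \<Longrightarrow> C \<in> \<pi> \<Longrightarrow> B \<noteq> C \<Longrightarrow> B \<inter> C = {}"
    and E: "{} \<notin> \<pi>"
    using p by (auto simp: partition_on_def disjoint_def)
  have eq: "\<pi> = image Inl ` left_part \<pi> \<union> image Inr ` right_part \<pi>"
    using b(2) by (rule left_right_image)
  have lr: "B \<in> left_part \<pi> \<Longrightarrow> Inl ` B \<in> \<pi>" "B \<in> right_part \<pi> \<Longrightarrow> Inr ` B \<in> \<pi>" for B
    by (auto simp: left_part_def right_part_def)
  have U': "Inl ` \<Union>(left_part \<pi>) \<union> Inr ` \<Union>(right_part \<pi>) = Inl ` {1..n} \<union> Inr ` {1..n}"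
    using U by (subst (asm) eq) (simp add: image_Union)
  have "\<Union>(left_part \<pi>) = {1..n}" "\<Union>(right_part \<pi>) = {1..n}"
    using arg_cong[OF U', of "vimage Inl"] arg_cong[OF U', of "vimage Inr"]
    by (simp_all add: vimage_def image_iff set_eq_iff)
  moreover have "B \<inter> C = {}" if "B \<in> left_part \<pi>" "C \<in> left_part \<pi>" "B \<noteq> C" for B C
    using D[OF lr(1) lr(1), OF that(1,2)] that(3) by (auto simp: image_Inl_Inr_eq)
  moreover have "B \<inter> C = {}" if "B \<in> right_part \<pi>" "C \<in> right_part \<pi>" "B \<noteq> C" for B C
    using D[OF lr(2) lr(2), OF that(1,2)] that(3) by (auto simp: image_Inl_Inr_eq)
  moreover have "{} \<notin> left_part \<pi>" "{} \<notin> right_part \<pi>" using E by (auto simp: left_part_def right_part_def)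
  moreover have "card B = 2" if "B \<in> left_part \<pi>" for B
    using b(1)[OF lr(1)[OF that]] by (simp add: card_image)
  moreover have "card B = 2" if "B \<in> right_part \<pi>" for B
    using b(1)[OF lr(2)[OF that]] by (simp add: card_image)
  ultimately show "left_part \<pi> \<in> pairings {1..n} (Min ` left_part \<pi>)"
    "right_part \<pi> \<in> pairings {1..n} (Min ` left_part \<pi>)"
    using m by (auto simp: pairings_def partition_on_def disjoint_def)
qed

lemma union_in_diag_pair_partitions:
  assumes \<rho>: "\<rho> \<in> pairings {1..n} Op" and \<sigma>: "\<sigma> \<in> pairings {1..n} Op"
  shows "image Inl ` \<rho> \<union> image Inr ` \<sigma> \<in> diag_pair_partitions n" (is "?\<pi> \<in> _")
proof -
  have e: "{} \<notin> \<rho>" "{} \<notin> \<sigma>" using \<rho> \<sigma> by (auto simp: pairings_def partition_on_def)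
  have U: "\<Union>\<rho> = {1..n}" "\<Union>\<sigma> = {1..n}" using \<rho> \<sigma> by (auto simp: pairings_def partition_on_def)
  have "\<Union>?\<pi> = Inl ` \<Union>\<rho> \<union> Inr ` \<Union>\<sigma>" by auto
  then have "\<Union>?\<pi> = Inl ` {1..n} \<union> Inr ` {1..n}" by (simp only: U)
  moreover have "disjoint ?\<pi>"
  proof (rule disjointI)
    fix B C assume "B \<in> ?\<pi>" "C \<in> ?\<pi>" "B \<noteq> C"
    moreover have "B' \<inter> C' = {}"
      if "B' \<in> \<rho> \<and> C' \<in> \<rho> \<or> B' \<in> \<sigma> \<and> C' \<in> \<sigma>" "B' \<noteq> C'" for B' C'
      using that \<rho> \<sigma> by (metis (mono_tags, lifting) disjointD mem_Collect_eq pairings_def partition_onD2)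
    ultimately show "B \<inter> C = {}" by (auto simp: image_Inl_Inr_eq)
  qed
  moreover have "{} \<notin> ?\<pi>" using e by auto
  moreover have "\<forall>B\<in>?\<pi>. card B = 2 \<and> (B \<subseteq> range Inl \<or> B \<subseteq> range Inr)"
    using \<rho> \<sigma> by (auto simp: pairings_def card_image)
  moreover have "Min ` left_part ?\<pi> = Min ` right_part ?\<pi>"
    unfolding left_right_part_union[OF e] using \<rho> \<sigma> by (auto simp: pairings_def)
  ultimately show ?thesis by (simp add: diag_pair_partitions_def partition_on_def)
qed

lemma sum_diag_pair_partitions:
  fixes f g :: "nat set set \<Rightarrow> 'c::comm_semiring_1"
  shows "(\<Sum>\<pi>\<in>diag_pair_partitions n. f (left_part \<pi>) * g (right_part \<pi>)) =
    (\<Sum>Op\<in>Pow {1..n}. sum f (pairings {1..n} Op) * sum g (pairings {1..n} Op))"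
proof -
  let ?P = "pairings {1..n}"
  have nonempty: "{} \<notin> \<rho>" if "\<rho> \<in> ?P Op" for \<rho> Op
    using that by (auto simp: pairings_def partition_on_def)
  have "(\<Sum>\<pi>\<in>diag_pair_partitions n. f (left_part \<pi>) * g (right_part \<pi>)) =
      (\<Sum>(Op, \<rho>, \<sigma>)\<in>(SIGMA Op:Pow {1..n}. ?P Op \<times> ?P Op). f \<rho> * g \<sigma>)"
  proof (rule sum.reindex_bij_witness[where
        i = "\<lambda>(Op, \<rho>, \<sigma>). image Inl ` \<rho> \<union> image Inr ` \<sigma>"
        and j = "\<lambda>\<pi>. (Min ` left_part \<pi>, left_part \<pi>, right_part \<pi>)"])
    fix \<pi> assume \<pi>: "\<pi> \<in> diag_pair_partitions n"
    show "(case (Min ` left_part \<pi>, left_part \<pi>, right_part \<pi>) of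
        (Op, \<rho>, \<sigma>) \<Rightarrow> image Inl ` \<rho> \<union> image Inr ` \<sigma>) = \<pi>"
      using left_right_image[of \<pi>] \<pi> by (simp add: diag_pair_partitions_def)
    show "(Min ` left_part \<pi>, left_part \<pi>, right_part \<pi>) \<in> (SIGMA Op:Pow {1..n}. ?P Op \<times> ?P Op)"
      using diag_pair_partition_parts[OF \<pi>] pairings_block(3)[OF diag_pair_partition_parts(1)[OF \<pi>]] by blast
  next
    fix b assume "b \<in> (SIGMA Op:Pow {1..n}. ?P Op \<times> ?P Op)"
    then obtain Op \<rho> \<sigma> where b: "b = (Op, \<rho>, \<sigma>)" "\<rho> \<in> ?P Op" "\<sigma> \<in> ?P Op" by auto
    note parts = left_right_part_union[OF nonempty[OF b(2)] nonempty[OF b(3)]]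
    show "(Min ` left_part (case b of (Op, \<rho>, \<sigma>) \<Rightarrow> image Inl ` \<rho> \<union> image Inr ` \<sigma>),
        left_part (case b of (Op, \<rho>, \<sigma>) \<Rightarrow> image Inl ` \<rho> \<union> image Inr ` \<sigma>),
        right_part (case b of (Op, \<rho>, \<sigma>) \<Rightarrow> image Inl ` \<rho> \<union> image Inr ` \<sigma>)) = b"
      using b by (simp add: parts) (simp add: pairings_def)
    show "(case b of (Op, \<rho>, \<sigma>) \<Rightarrow> image Inl ` \<rho> \<union> image Inr ` \<sigma>) \<in> diag_pair_partitions n"
      using b by (auto intro: union_in_diag_pair_partitions)
  qed auto
  also have "\<dots> = (\<Sum>Op\<in>Pow {1..n}. \<Sum>(\<rho>, \<sigma>)\<in>?P Op \<times> ?P Op. f \<rho> * g \<sigma>)"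
    by (rule sum.Sigma[symmetric]) (auto intro: finite_pairings)
  finally show ?thesis by (simp add: sum_product sum.cartesian_product)
qed

theorem theorem4p7:
  fixes q t v w :: real
    and n :: nat
    and \<xi> :: "nat \<Rightarrow> 'a::{real_inner, complete_space, second_countable_topology}"
    and \<eta> :: "nat \<Rightarrow> 'b::{real_inner, complete_space, second_countable_topology}"
  assumes "\<bar>q\<bar> \<le> t" and "t \<le> 1" and "\<bar>v\<bar> \<le> w" and "w \<le> 1" and "n \<ge> 1"
  shows "vacuum_state q t v w (G_prod q t v w \<xi> \<eta> n) =
    (\<Sum>\<pi>\<in>diag_pair_partitions n.
       complex_of_real (q ^ crossings (left_part \<pi>) * t ^ nestings (left_part \<pi>) *
                        v ^ crossings (right_part \<pi>) * w ^ nestings (right_part \<pi>)) *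
       (\<Prod>B\<in>left_part \<pi>. cinner (cplx (\<xi> (Min B))) (cplx (\<xi> (Max B)))) *
       (\<Prod>B\<in>right_part \<pi>. cinner (cplx (\<eta> (Min B))) (cplx (\<eta> (Max B)))))"
proof -
  have "vacuum_state q t v w (G_prod q t v w \<xi> \<eta> n) =
      vacuum_coeff q t v w \<xi> \<eta> n (pure_tensor (tensor_at \<xi> []) (tensor_at \<eta> []))"
    by (simp add: vacuum_state_def vacuum_coeff_def pure_tensor_Nil)
  also have "\<dots> = (\<Sum>Op\<in>Pow {1..n}. pairing_sum q t (gram \<xi>) {1..n} Op * pairing_sum v w (gram \<eta>) {1..n} Op)"
    by (subst vacuum_coeff_pure) simp_all
  also have "\<dots> = (\<Sum>\<pi>\<in>diag_pair_partitions n.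
      weight q t (gram \<xi>) (left_part \<pi>) * weight v w (gram \<eta>) (right_part \<pi>))"
    unfolding pairing_sum_def by (rule sum_diag_pair_partitions[symmetric])
  finally show ?thesis by (simp add: weight_def mult_ac)
qed

end
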